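(* Let $\mathbf{I}$ be a small category. Then $\mathbf{I}$-colimits commute with inverse images in $\mathbf{Set}$ (that is, the colimit functor $\varinjlim \colon \mathbf{Set}^{\mathbf{I}} \to \mathbf{Set}$ preserves pullback squares in which one leg is a monomorphism) if and only if $\mathbf{I}$ is confluent.
   Context: An inverse image diagram is a pullback square in which one leg is a monomorphism, i.e. a pullback of a monomorphism along an arbitrary morphism. A category $\mathbf{I}$ is confluent if for every pair of arrows with the same domain, $\alpha_i \colon I \to I_i$ ($i = 1,2$), there exist an object $J$ and arrows $\beta_i \colon I_i \to J$ ($i=1,2$) with $\beta_1\alpha_1 = \beta_2\alpha_2$. *)

theory Defs
  imports "HOL-Library.FuncSet" "HOL-Library.Equipollence"
begin

section \<open>Categories\<close>

record ('o, 'm) cat =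
  Ob :: "'o set"
  Mor :: "'m set"
  Dom :: "'m \<Rightarrow> 'o"
  Cod :: "'m \<Rightarrow> 'o"
  Id :: "'o \<Rightarrow> 'm"
  Comp :: "'m \<Rightarrow> 'm \<Rightarrow> 'm"  \<comment> \<open>\<open>Comp C g f\<close> is \<open>g\<close> after \<open>f\<close>; junk if the two are not composable\<close>

definition hom :: "('o, 'm) cat \<Rightarrow> 'o \<Rightarrow> 'o \<Rightarrow> 'm set" where
  "hom C a b = {f \<in> Mor C. Dom C f = a \<and> Cod C f = b}"

locale category =
  fixes C :: "('o, 'm) cat"
  assumes Dom_in_Ob: "f \<in> Mor C \<Longrightarrow> Dom C f \<in> Ob C"
    and Cod_in_Ob: "f \<in> Mor C \<Longrightarrow> Cod C f \<in> Ob C"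
    and Id_in_hom: "a \<in> Ob C \<Longrightarrow> Id C a \<in> hom C a a"
    and Comp_in_hom: "\<lbrakk>f \<in> hom C a b; g \<in> hom C b c\<rbrakk> \<Longrightarrow> Comp C g f \<in> hom C a c"
    and Comp_Id_right: "f \<in> hom C a b \<Longrightarrow> Comp C f (Id C a) = f"
    and Comp_Id_left: "f \<in> hom C a b \<Longrightarrow> Comp C (Id C b) f = f"
    and Comp_assoc: "\<lbrakk>f \<in> hom C a b; g \<in> hom C b c; h \<in> hom C c d\<rbrakk>
      \<Longrightarrow> Comp C h (Comp C g f) = Comp C (Comp C h g) f"

definition confluent :: "('o, 'm) cat \<Rightarrow> bool" where
  "confluent C \<longleftrightarrow>
    (\<forall>\<alpha>\<^sub>1\<in>Mor C. \<forall>\<alpha>\<^sub>2\<in>Mor C. Dom C \<alpha>\<^sub>1 = Dom C \<alpha>\<^sub>2 \<longrightarrow>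
      (\<exists>j\<in>Ob C. \<exists>\<beta>\<^sub>1\<in>hom C (Cod C \<alpha>\<^sub>1) j. \<exists>\<beta>\<^sub>2\<in>hom C (Cod C \<alpha>\<^sub>2) j.
        Comp C \<beta>\<^sub>1 \<alpha>\<^sub>1 = Comp C \<beta>\<^sub>2 \<alpha>\<^sub>2))"

definition monic :: "('o, 'm) cat \<Rightarrow> 'm \<Rightarrow> bool" where
  "monic C m \<longleftrightarrow> m \<in> Mor C \<and>
    (\<forall>x\<in>Mor C. \<forall>y\<in>Mor C. Dom C x = Dom C y \<and> Cod C x = Dom C m \<and> Cod C y = Dom C m \<and>
      Comp C m x = Comp C m y \<longrightarrow> x = y)"

text \<open>The square has cospan \<open>f\<close>, \<open>g\<close> and projections \<open>p\<close>, \<open>q\<close>, with \<open>f \<circ> p = g \<circ> q\<close>.\<close>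

definition pullback_square :: "('o, 'm) cat \<Rightarrow> 'm \<Rightarrow> 'm \<Rightarrow> 'm \<Rightarrow> 'm \<Rightarrow> bool" where
  "pullback_square C p q f g \<longleftrightarrow>
    p \<in> Mor C \<and> q \<in> Mor C \<and> f \<in> Mor C \<and> g \<in> Mor C \<and>
    Dom C p = Dom C q \<and> Cod C p = Dom C f \<and> Cod C q = Dom C g \<and> Cod C f = Cod C g \<and>
    Comp C f p = Comp C g q \<and>
    (\<forall>x\<in>Mor C. \<forall>y\<in>Mor C.
      Dom C x = Dom C y \<and> Cod C x = Dom C f \<and> Cod C y = Dom C g \<and> Comp C f x = Comp C g y \<longrightarrow>
      (\<exists>!h. h \<in> hom C (Dom C x) (Dom C p) \<and> Comp C p h = x \<and> Comp C q h = y))"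

definition inverse_image_square :: "('o, 'm) cat \<Rightarrow> 'm \<Rightarrow> 'm \<Rightarrow> 'm \<Rightarrow> 'm \<Rightarrow> bool" where
  "inverse_image_square C p q f m \<longleftrightarrow> pullback_square C p q f m \<and> monic C m"


section \<open>Functors and natural transformations\<close>

text \<open>
  Functors and natural transformations are required to be extensional, so that equality in HOL
  coincides with equality of functors and of natural transformations.
\<close>

record ('o, 'm, 'p, 'n) fctr =
  FOb :: "'o \<Rightarrow> 'p"
  FMor :: "'m \<Rightarrow> 'n"

definition is_functor ::
  "('o, 'm) cat \<Rightarrow> ('p, 'n) cat \<Rightarrow> ('o, 'm, 'p, 'n) fctr \<Rightarrow> bool" where
  "is_functor C D F \<longleftrightarrow>
    FOb F \<in> Ob C \<rightarrow>\<^sub>E Ob D \<and>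
    FMor F \<in> Mor C \<rightarrow>\<^sub>E Mor D \<and>
    (\<forall>f\<in>Mor C. FMor F f \<in> hom D (FOb F (Dom C f)) (FOb F (Cod C f))) \<and>
    (\<forall>a\<in>Ob C. FMor F (Id C a) = Id D (FOb F a)) \<and>
    (\<forall>f\<in>Mor C. \<forall>g\<in>Mor C. Cod C f = Dom C g \<longrightarrow>
      FMor F (Comp C g f) = Comp D (FMor F g) (FMor F f))"

record ('o, 'm, 'p, 'n) nat_trans =
  Src :: "('o, 'm, 'p, 'n) fctr"
  Tgt :: "('o, 'm, 'p, 'n) fctr"
  At :: "'o \<Rightarrow> 'n"

definition is_nat_trans ::
  "('o, 'm) cat \<Rightarrow> ('p, 'n) cat \<Rightarrow> ('o, 'm, 'p, 'n) nat_trans \<Rightarrow> bool" where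
  "is_nat_trans C D \<tau> \<longleftrightarrow>
    is_functor C D (Src \<tau>) \<and> is_functor C D (Tgt \<tau>) \<and>
    At \<tau> \<in> (\<Pi>\<^sub>E a\<in>Ob C. hom D (FOb (Src \<tau>) a) (FOb (Tgt \<tau>) a)) \<and>
    (\<forall>f\<in>Mor C.
      Comp D (At \<tau> (Cod C f)) (FMor (Src \<tau>) f) = Comp D (FMor (Tgt \<tau>) f) (At \<tau> (Dom C f)))"

definition functor_cat :: "('o, 'm) cat \<Rightarrow> ('p, 'n) cat \<Rightarrow>
    (('o, 'm, 'p, 'n) fctr, ('o, 'm, 'p, 'n) nat_trans) cat" where
  "functor_cat C D = \<lparr>
    Ob = {F. is_functor C D F},
    Mor = {\<tau>. is_nat_trans C D \<tau>},
    Dom = Src,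
    Cod = Tgt,
    Id = (\<lambda>F. \<lparr>Src = F, Tgt = F, At = (\<lambda>a\<in>Ob C. Id D (FOb F a))\<rparr>),
    Comp = (\<lambda>\<sigma> \<tau>. \<lparr>Src = Src \<tau>, Tgt = Tgt \<sigma>, At = (\<lambda>a\<in>Ob C. Comp D (At \<sigma> a) (At \<tau> a))\<rparr>)\<rparr>"


section \<open>Colimits\<close>

definition const_functor :: "('o, 'm) cat \<Rightarrow> ('p, 'n) cat \<Rightarrow> 'p \<Rightarrow> ('o, 'm, 'p, 'n) fctr" where
  "const_functor J C x = \<lparr>FOb = (\<lambda>i\<in>Ob J. x), FMor = (\<lambda>u\<in>Mor J. Id C x)\<rparr>"

definition cocone :: "('o, 'm) cat \<Rightarrow> ('p, 'n) cat \<Rightarrow> ('o, 'm, 'p, 'n) fctr \<Rightarrow>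
    'p \<Rightarrow> ('o, 'm, 'p, 'n) nat_trans \<Rightarrow> bool" where
  "cocone J C F x \<eta> \<longleftrightarrow> x \<in> Ob C \<and> \<eta> \<in> hom (functor_cat J C) F (const_functor J C x)"

definition colimit_cocone :: "('o, 'm) cat \<Rightarrow> ('p, 'n) cat \<Rightarrow> ('o, 'm, 'p, 'n) fctr \<Rightarrow>
    'p \<Rightarrow> ('o, 'm, 'p, 'n) nat_trans \<Rightarrow> bool" where
  "colimit_cocone J C F x \<eta> \<longleftrightarrow> cocone J C F x \<eta> \<and>
    (\<forall>y \<kappa>. cocone J C F y \<kappa> \<longrightarrow>
      (\<exists>!h. h \<in> hom C x y \<and> (\<forall>i\<in>Ob J. Comp C h (At \<eta> i) = At \<kappa> i)))"

text \<open>
  The functor \<open>colim : C\<^sup>J \<rightarrow> C\<close>: it sends each diagram \<open>F\<close> to the vertex of a colimit cocone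
  \<open>\<eta> F\<close> and each \<open>\<tau>\<close> to the morphism it induces between the vertices. It is determined only up to
  natural isomorphism, by the choice of the colimit cocones.
\<close>

definition colimit_functor :: "('o, 'm) cat \<Rightarrow> ('p, 'n) cat \<Rightarrow>
    (('o, 'm, 'p, 'n) fctr, ('o, 'm, 'p, 'n) nat_trans, 'p, 'n) fctr \<Rightarrow>
    (('o, 'm, 'p, 'n) fctr \<Rightarrow> ('o, 'm, 'p, 'n) nat_trans) \<Rightarrow> bool" where
  "colimit_functor J C L \<eta> \<longleftrightarrow>
    is_functor (functor_cat J C) C L \<and>
    (\<forall>F\<in>Ob (functor_cat J C). colimit_cocone J C F (FOb L F) (\<eta> F)) \<and>
    (\<forall>\<tau>\<in>Mor (functor_cat J C). \<forall>i\<in>Ob J.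
      Comp C (FMor L \<tau>) (At (\<eta> (Src \<tau>)) i) = Comp C (At (\<eta> (Tgt \<tau>)) i) (At \<tau> i))"

definition preserves_inverse_images ::
  "('o, 'm) cat \<Rightarrow> ('p, 'n) cat \<Rightarrow> ('o, 'm, 'p, 'n) fctr \<Rightarrow> bool" where
  "preserves_inverse_images C D F \<longleftrightarrow>
    (\<forall>p q f m. inverse_image_square C p q f m \<longrightarrow>
      pullback_square D (FMor F p) (FMor F q) (FMor F f) (FMor F m))"

definition colimits_commute_with_inverse_images :: "('o, 'm) cat \<Rightarrow> ('p, 'n) cat \<Rightarrow> bool" where
  "colimits_commute_with_inverse_images J C \<longleftrightarrow>
    (\<forall>L \<eta>. colimit_functor J C L \<eta> \<longrightarrow> preserves_inverse_images (functor_cat J C) C L)"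


section \<open>The category of sets\<close>

text \<open>
  Sets are the subsets of a type \<open>'u\<close>, which plays the role of the universe. A map is a triple of
  its domain, its codomain and an extensional function. A category \<open>J\<close> is small relative to
  this universe if \<open>Mor J \<lesssim> (UNIV :: 'u set)\<close> (the objects embed into \<open>Mor J\<close> through the
  identities); if moreover \<open>'u\<close> is infinite, then a colimit functor exists
  (\<open>set_cat_colimit_functor_exists\<close> below), so quantifying over all of them is not vacuous.
\<close>

definition set_cat :: "('u set, 'u set \<times> 'u set \<times> ('u \<Rightarrow> 'u)) cat" where
  "set_cat = \<lparr>
    Ob = UNIV,
    Mor = {(A, B, f). f \<in> A \<rightarrow>\<^sub>E B},
    Dom = (\<lambda>(A, B, f). A),
    Cod = (\<lambda>(A, B, f). B),
    Id = (\<lambda>A. (A, A, \<lambda>x\<in>A. x)),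
    Comp = (\<lambda>(B, C, g) (A, B', f). (A, C, compose A g f))\<rparr>"


section \<open>Existence of the colimit functor\<close>

lemma category_set_cat: "category set_cat"
  by unfold_locales
    (force simp: set_cat_def hom_def compose_def PiE_iff extensional_def fun_eq_iff)+

lemma hom_set_cat: "h \<in> hom set_cat A B \<longleftrightarrow> (\<exists>f \<in> A \<rightarrow>\<^sub>E B. h = (A, B, f))"
  by (auto simp: hom_def set_cat_def)

lemma Comp_set_cat: "Comp set_cat (B, C, g) (A, B', f) = (A, C, \<lambda>x\<in>A. g (f x))"
  by (simp add: set_cat_def compose_def)

lemma category_functor_cat:
  assumes "category C" "category D"
  shows "category (functor_cat C D)"
proof -
  interpret C: category C by fact
  interpret D: category D by fact
  have At: "At \<tau> a \<in> hom D (FOb (Src \<tau>) a) (FOb (Tgt \<tau>) a)"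
    if "is_nat_trans C D \<tau>" "a \<in> Ob C" for \<tau> a
    using that by (auto simp: is_nat_trans_def)
  have ext: "At \<tau> \<in> extensional (Ob C)" if "is_nat_trans C D \<tau>" for \<tau>
    using that by (auto simp: is_nat_trans_def PiE_iff)
  have fh: "FMor F f \<in> hom D (FOb F (Dom C f)) (FOb F (Cod C f))"
    if "is_functor C D F" "f \<in> Mor C" for F f
    using that by (auto simp: is_functor_def)
  have comp: "is_nat_trans C D \<lparr>Src = Src \<tau>, Tgt = Tgt \<sigma>, At = (\<lambda>a\<in>Ob C. Comp D (At \<sigma> a) (At \<tau> a))\<rparr>"
    if t: "is_nat_trans C D \<tau>" and s: "is_nat_trans C D \<sigma>" and e: "Tgt \<tau> = Src \<sigma>" for \<sigma> \<tau>
    unfolding is_nat_trans_def nat_trans.simps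
  proof (intro conjI ballI)
    show "is_functor C D (Src \<tau>)" "is_functor C D (Tgt \<sigma>)" using s t by (auto simp: is_nat_trans_def)
    show "(\<lambda>a\<in>Ob C. Comp D (At \<sigma> a) (At \<tau> a)) \<in> (\<Pi>\<^sub>E a\<in>Ob C. hom D (FOb (Src \<tau>) a) (FOb (Tgt \<sigma>) a))"
      using At[OF t] At[OF s] e by (auto intro!: D.Comp_in_hom)
    fix f assume f: "f \<in> Mor C"
    let ?a = "Dom C f" and ?b = "Cod C f"
    note ab = C.Dom_in_Ob[OF f] C.Cod_in_Ob[OF f]
    have fn: "is_functor C D (Src \<tau>)" "is_functor C D (Tgt \<sigma>)" "is_functor C D (Src \<sigma>)"
      using s t by (auto simp: is_nat_trans_def)
    have nt: "Comp D (At \<tau> ?b) (FMor (Src \<tau>) f) = Comp D (FMor (Src \<sigma>) f) (At \<tau> ?a)"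
      using t e f by (auto simp: is_nat_trans_def)
    have ns: "Comp D (At \<sigma> ?b) (FMor (Src \<sigma>) f) = Comp D (FMor (Tgt \<sigma>) f) (At \<sigma> ?a)"
      using s f by (auto simp: is_nat_trans_def)
    note h = At[OF t ab(1), unfolded e] At[OF t ab(2), unfolded e] At[OF s ab(1)] At[OF s ab(2)]
      fh[OF fn(1) f] fh[OF fn(2) f] fh[OF fn(3) f]
    show "Comp D ((\<lambda>a\<in>Ob C. Comp D (At \<sigma> a) (At \<tau> a)) ?b) (FMor (Src \<tau>) f) =
          Comp D (FMor (Tgt \<sigma>) f) ((\<lambda>a\<in>Ob C. Comp D (At \<sigma> a) (At \<tau> a)) ?a)"
      using ab
      by (simp add: D.Comp_assoc[OF h(5) h(2) h(4), symmetric] nt D.Comp_assoc[OF h(1) h(3) h(6)]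
            ns[symmetric] D.Comp_assoc[OF h(1) h(7) h(4)])
  qed
  show ?thesis
  proof
    fix F assume "F \<in> Ob (functor_cat C D)"
    then have F: "is_functor C D F" by (simp add: functor_cat_def)
    then have FO: "a \<in> Ob C \<Longrightarrow> FOb F a \<in> Ob D" for a by (auto simp: is_functor_def)
    have "is_nat_trans C D \<lparr>Src = F, Tgt = F, At = (\<lambda>a\<in>Ob C. Id D (FOb F a))\<rparr>"
      using F C.Dom_in_Ob C.Cod_in_Ob FO
      by (auto simp: is_nat_trans_def D.Id_in_hom D.Comp_Id_left[OF fh[OF F]] D.Comp_Id_right[OF fh[OF F]])
    then show "Id (functor_cat C D) F \<in> hom (functor_cat C D) F F"
      by (simp add: functor_cat_def hom_def)
  next
    fix f assume "f \<in> Mor (functor_cat C D)"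
    then show "Dom (functor_cat C D) f \<in> Ob (functor_cat C D)"
      "Cod (functor_cat C D) f \<in> Ob (functor_cat C D)"
      by (auto simp: functor_cat_def is_nat_trans_def)
  next
    fix f a b g c
    assume "f \<in> hom (functor_cat C D) a b" "g \<in> hom (functor_cat C D) b c"
    then show "Comp (functor_cat C D) g f \<in> hom (functor_cat C D) a c"
      using comp by (auto simp: functor_cat_def hom_def)
  next
    fix f a b assume "f \<in> hom (functor_cat C D) a b"
    then have f: "is_nat_trans C D f" "Src f = a" "Tgt f = b" by (auto simp: functor_cat_def hom_def)
    show "Comp (functor_cat C D) f (Id (functor_cat C D) a) = f"
      "Comp (functor_cat C D) (Id (functor_cat C D) b) f = f"
      using f ext[OF f(1)] D.Comp_Id_right[OF At[OF f(1)]] D.Comp_Id_left[OF At[OF f(1)]]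
      by (auto simp: functor_cat_def fun_eq_iff extensional_def intro!: nat_trans.equality)
  next
    fix f a b g c h d
    assume "f \<in> hom (functor_cat C D) a b" "g \<in> hom (functor_cat C D) b c" "h \<in> hom (functor_cat C D) c d"
    then have f: "is_nat_trans C D f" "Src f = a" "Tgt f = b"
      and g: "is_nat_trans C D g" "Src g = b" "Tgt g = c"
      and h: "is_nat_trans C D h" "Src h = c" "Tgt h = d"
      by (auto simp: functor_cat_def hom_def)
    show "Comp (functor_cat C D) h (Comp (functor_cat C D) g f) =
      Comp (functor_cat C D) (Comp (functor_cat C D) h g) f"
      using D.Comp_assoc[OF At[OF f(1), unfolded f] At[OF g(1), unfolded g] At[OF h(1), unfolded h]]
      by (auto simp: functor_cat_def fun_eq_iff)
  qed
qed

lemma coconeD1: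
  assumes "cocone J C F x e"
  shows "is_functor J C F" "x \<in> Ob C" "is_nat_trans J C e" "Src e = F" "Tgt e = const_functor J C x"
  using assms by (auto simp: cocone_def functor_cat_def hom_def is_nat_trans_def)

lemma coconeD:
  assumes "cocone J C F x e"
  shows "i \<in> Ob J \<Longrightarrow> At e i \<in> hom C (FOb F i) x"
proof -
  assume i: "i \<in> Ob J"
  have "At e i \<in> hom C (FOb (Src e) i) (FOb (Tgt e) i)"
    using i coconeD1(3)[OF assms] by (auto simp: is_nat_trans_def)
  then show "At e i \<in> hom C (FOb F i) x" using i coconeD1[OF assms] by (simp add: const_functor_def)
qed

lemma coconeD2:
  assumes "category J" "category C" "cocone J C F x e" and u: "u \<in> Mor J"
  shows "Comp C (At e (Cod J u)) (FMor F u) = At e (Dom J u)"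
proof -
  have "Comp C (At e (Cod J u)) (FMor F u) = Comp C (Id C x) (At e (Dom J u))"
    using u coconeD1[OF assms(3)] by (simp add: is_nat_trans_def const_functor_def)
  with category.Comp_Id_left[OF assms(2) coconeD[OF assms(3) category.Dom_in_Ob[OF assms(1) u]]]
  show ?thesis by simp
qed

lemma cocone_exI:
  assumes "category J" "category C"
    and F: "is_functor J C F" and y: "y \<in> Ob C" and k: "\<And>i. i \<in> Ob J \<Longrightarrow> k i \<in> hom C (FOb F i) y"
    and n: "\<And>u. u \<in> Mor J \<Longrightarrow> Comp C (k (Cod J u)) (FMor F u) = k (Dom J u)"
  shows "cocone J C F y \<lparr>Src = F, Tgt = const_functor J C y, At = (\<lambda>i\<in>Ob J. k i)\<rparr>"
proof -
  interpret J: category J by fact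
  interpret C: category C by fact
  have idy: "Id C y \<in> Mor C" "Dom C (Id C y) = y" "Cod C (Id C y) = y"
    using C.Id_in_hom[OF y] by (auto simp: hom_def)
  have c: "is_functor J C (const_functor J C y)"
    using y C.Comp_Id_left[OF C.Id_in_hom[OF y]] J.Id_in_hom J.Comp_in_hom J.Dom_in_Ob J.Cod_in_Ob
    by (auto simp: is_functor_def const_functor_def hom_def idy)
  have "is_nat_trans J C \<lparr>Src = F, Tgt = const_functor J C y, At = (\<lambda>i\<in>Ob J. k i)\<rparr>"
    using F k n c J.Dom_in_Ob J.Cod_in_Ob C.Comp_Id_left[OF k]
    by (auto simp: is_nat_trans_def) (auto simp: const_functor_def)
  then show ?thesis
    using y by (simp add: cocone_def functor_cat_def hom_def)
qed

lemma colimit_functor_exists: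
  assumes "category J" "category C"
    and ex: "\<And>F. is_functor J C F \<Longrightarrow> \<exists>x \<eta>. colimit_cocone J C F x \<eta>"
  shows "\<exists>L \<eta>. colimit_functor J C L \<eta>"
proof -
  interpret J: category J by fact
  interpret C: category C by fact
  let ?D = "functor_cat J C"
  interpret D: category ?D using assms by (intro category_functor_cat)
  from ex obtain X e where Xe: "\<And>F. is_functor J C F \<Longrightarrow> colimit_cocone J C F (X F) (e F)" by metis
  have eat: "At (e F) i \<in> hom C (FOb F i) (X F)" if "is_functor J C F" "i \<in> Ob J" for F i
    using coconeD[OF _ that(2)] Xe[OF that(1)] by (auto simp: colimit_cocone_def)
  have enat: "Comp C (At (e F) (Cod J u)) (FMor F u) = At (e F) (Dom J u)"
    if "is_functor J C F" "u \<in> Mor J" for F u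
    using coconeD2[OF assms(1,2) _ that(2)] Xe[OF that(1)] by (auto simp: colimit_cocone_def)
  have XO: "X F \<in> Ob C" if "is_functor J C F" for F
    using Xe[OF that] by (simp add: colimit_cocone_def cocone_def)
  have univ: "\<exists>!h. h \<in> hom C (X F) y \<and> (\<forall>i\<in>Ob J. Comp C h (At (e F) i) = k i)"
    if F: "is_functor J C F" and y: "y \<in> Ob C" and k: "\<And>i. i \<in> Ob J \<Longrightarrow> k i \<in> hom C (FOb F i) y"
      and n: "\<And>u. u \<in> Mor J \<Longrightarrow> Comp C (k (Cod J u)) (FMor F u) = k (Dom J u)" for F y k
  proof -
    have "\<exists>!h. h \<in> hom C (X F) y \<and> (\<forall>i\<in>Ob J. Comp C h (At (e F) i) =
        At \<lparr>Src = F, Tgt = const_functor J C y, At = (\<lambda>i\<in>Ob J. k i)\<rparr> i)"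
      using conjunct2[OF Xe[OF F, unfolded colimit_cocone_def]] cocone_exI[OF assms(1,2) F y k n]
      by blast
    then show ?thesis by (simp cong: conj_cong ball_cong)
  qed
  let ?P = "\<lambda>t h. h \<in> hom C (X (Src t)) (X (Tgt t)) \<and>
    (\<forall>i\<in>Ob J. Comp C h (At (e (Src t)) i) = Comp C (At (e (Tgt t)) i) (At t i))"
  have ex1: "\<exists>!h. ?P t h" if t: "is_nat_trans J C t" for t
  proof (rule univ)
    show S: "is_functor J C (Src t)" using t by (simp add: is_nat_trans_def)
    have T: "is_functor J C (Tgt t)" using t by (simp add: is_nat_trans_def)
    show "X (Tgt t) \<in> Ob C" using XO[OF T] .
    have at: "At t i \<in> hom C (FOb (Src t) i) (FOb (Tgt t) i)" if "i \<in> Ob J" for i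
      using t that by (auto simp: is_nat_trans_def)
    show "Comp C (At (e (Tgt t)) i) (At t i) \<in> hom C (FOb (Src t) i) (X (Tgt t))" if "i \<in> Ob J" for i
      using C.Comp_in_hom[OF at[OF that] eat[OF T that]] .
    fix u assume u: "u \<in> Mor J"
    note ab = J.Dom_in_Ob[OF u] J.Cod_in_Ob[OF u]
    have fs: "FMor (Src t) u \<in> hom C (FOb (Src t) (Dom J u)) (FOb (Src t) (Cod J u))"
     and ft: "FMor (Tgt t) u \<in> hom C (FOb (Tgt t) (Dom J u)) (FOb (Tgt t) (Cod J u))"
      using S T u by (auto simp: is_functor_def)
    have nt: "Comp C (At t (Cod J u)) (FMor (Src t) u) = Comp C (FMor (Tgt t) u) (At t (Dom J u))"
      using t u by (auto simp: is_nat_trans_def)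
    show "Comp C (Comp C (At (e (Tgt t)) (Cod J u)) (At t (Cod J u))) (FMor (Src t) u) =
      Comp C (At (e (Tgt t)) (Dom J u)) (At t (Dom J u))"
      by (simp add: C.Comp_assoc[OF fs at[OF ab(2)] eat[OF T ab(2)], symmetric] nt
         C.Comp_assoc[OF at[OF ab(1)] ft eat[OF T ab(2)]] enat[OF T u])
  qed
  then have "\<exists>M. \<forall>t. is_nat_trans J C t \<longrightarrow> ?P t (M t)" by metis
  then obtain M where M: "\<And>t. is_nat_trans J C t \<Longrightarrow> ?P t (M t)" by blast
  have uniq: "h = M t" if "is_nat_trans J C t" "?P t h" for t h
    using ex1[OF that(1)] that(2) M[OF that(1)] by blast
  let ?L = "\<lparr>FOb = (\<lambda>F\<in>Ob ?D. X F), FMor = (\<lambda>t\<in>Mor ?D. M t)\<rparr>"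
  have D: "Ob ?D = {F. is_functor J C F}" "Mor ?D = {t. is_nat_trans J C t}" "Dom ?D = Src" "Cod ?D = Tgt"
    by (simp_all add: functor_cat_def)
  have ob: "is_functor J C (Src t)" "is_functor J C (Tgt t)" if "is_nat_trans J C t" for t
    using that by (simp_all add: is_nat_trans_def)
  have "is_functor ?D C ?L"
    unfolding is_functor_def
  proof (intro conjI ballI impI)
    show "FOb ?L \<in> Ob ?D \<rightarrow>\<^sub>E Ob C" using XO by (auto simp: D)
    show "FMor ?L \<in> Mor ?D \<rightarrow>\<^sub>E Mor C" using M by (auto simp: D hom_def)
    show "FMor ?L f \<in> hom C (FOb ?L (Dom ?D f)) (FOb ?L (Cod ?D f))" if "f \<in> Mor ?D" for f
      using M that ob by (auto simp: D)
    show "FMor ?L (Id ?D F) = Id C (FOb ?L F)" if F: "F \<in> Ob ?D" for F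
    proof -
      have I: "is_nat_trans J C (Id ?D F)" "Src (Id ?D F) = F" "Tgt (Id ?D F) = F"
        using D.Id_in_hom[OF F] by (auto simp: hom_def D)
      have F': "is_functor J C F" using F by (simp add: D)
      have "Id C (X F) = M (Id ?D F)"
        using C.Id_in_hom[OF XO[OF F']] C.Comp_Id_left[OF eat[OF F']] C.Comp_Id_right[OF eat[OF F']]
        by (intro uniq) (auto simp: I, simp add: functor_cat_def)
      then show ?thesis using I F by (simp add: D)
    qed
    fix f g assume f: "f \<in> Mor ?D" and g: "g \<in> Mor ?D" and fg: "Cod ?D f = Dom ?D g"
    have c: "is_nat_trans J C (Comp ?D g f)" "Src (Comp ?D g f) = Src f" "Tgt (Comp ?D g f) = Tgt g"
      using D.Comp_in_hom[of f "Src f" "Src g" g "Tgt g"] f g fg by (auto simp: hom_def D)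
    have cat: "At (Comp ?D g f) i = Comp C (At g i) (At f i)" if "i \<in> Ob J" for i
      using that by (simp add: functor_cat_def)
    have nf: "is_nat_trans J C f" and ng: "is_nat_trans J C g" and e: "Tgt f = Src g" using f g fg by (simp_all add: D)
    have hf: "M f \<in> hom C (X (Src f)) (X (Src g))" and hg: "M g \<in> hom C (X (Src g)) (X (Tgt g))"
      using M[OF nf] M[OF ng] e by auto
    have "Comp C (M g) (M f) = M (Comp ?D g f)"
    proof (intro uniq c(1) conjI ballI)
      show "Comp C (M g) (M f) \<in> hom C (X (Src (Comp ?D g f))) (X (Tgt (Comp ?D g f)))"
        unfolding c by (rule C.Comp_in_hom[OF hf hg])
      fix i assume i: "i \<in> Ob J"
      have at: "At f i \<in> hom C (FOb (Src f) i) (FOb (Src g) i)" "At g i \<in> hom C (FOb (Src g) i) (FOb (Tgt g) i)"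
        using nf ng i e by (auto simp: is_nat_trans_def)
      have e1: "Comp C (M f) (At (e (Src f)) i) = Comp C (At (e (Src g)) i) (At f i)"
        using M[OF nf] i \<open>Tgt f = Src g\<close> by auto
      have e2: "Comp C (M g) (At (e (Src g)) i) = Comp C (At (e (Tgt g)) i) (At g i)"
        using M[OF ng] i by auto
      show "Comp C (Comp C (M g) (M f)) (At (e (Src (Comp ?D g f))) i) =
        Comp C (At (e (Tgt (Comp ?D g f))) i) (At (Comp ?D g f) i)"
        unfolding c cat[OF i]
        by (simp add: C.Comp_assoc[OF eat[OF ob(1)[OF nf] i] hf hg, symmetric] e1
           C.Comp_assoc[OF at(1) eat[OF ob(1)[OF ng] i] hg] e2
           C.Comp_assoc[OF at eat[OF ob(2)[OF ng] i]])
    qed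
    then show "FMor ?L (Comp ?D g f) = Comp C (FMor ?L g) (FMor ?L f)"
      using f g c by (simp add: D)
  qed
  moreover have "\<forall>F\<in>Ob ?D. colimit_cocone J C F (FOb ?L F) (e F)" using Xe by (simp add: D)
  moreover have "\<forall>t\<in>Mor ?D. \<forall>i\<in>Ob J. Comp C (FMor ?L t) (At (e (Src t)) i) = Comp C (At (e (Tgt t)) i) (At t i)"
    using M by (simp add: D)
  ultimately have "colimit_functor J C ?L e" unfolding colimit_functor_def by blast
  then show ?thesis by blast
qed


lemma set_cat_colimit_exists:
  includes cardinal_syntax
  fixes J :: "('o, 'm) cat"
  assumes J: "category J" and inf: "infinite (UNIV :: 'u set)" and small: "Mor J \<lesssim> (UNIV :: 'u set)"
    and F: "is_functor J (set_cat :: ('u set, 'u set \<times> 'u set \<times> ('u \<Rightarrow> 'u)) cat) F"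
  shows "\<exists>x \<eta>. colimit_cocone J set_cat F x \<eta>"
proof -
  let ?S = "set_cat :: ('u set, 'u set \<times> 'u set \<times> ('u \<Rightarrow> 'u)) cat"
  interpret J: category J by fact
  from small obtain m :: "'m \<Rightarrow> 'u" where m: "inj_on m (Mor J)" by (auto simp: lepoll_def)
  have "|UNIV \<times> UNIV :: ('u\<times>'u) set| =o |UNIV :: 'u set|" using inf by (rule card_of_Times_same_infinite)
  then obtain p :: "'u \<times> 'u \<Rightarrow> 'u" where p: "inj p"
    by (metis UNIV_Times_UNIV bij_betw_imp_inj_on card_of_ordIso)
  have idi: "inj_on (Id J) (Ob J)" using J.Id_in_hom unfolding inj_on_def hom_def by (metis (mono_tags, lifting) mem_Collect_eq)
  have IdM: "i \<in> Ob J \<Longrightarrow> Id J i \<in> Mor J" for i using J.Id_in_hom by (auto simp: hom_def)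
  define U where "U = Sigma (Ob J) (FOb F)"
  define ap where "ap u = snd (snd (FMor F u))" for u
  define code where "code = (\<lambda>(i, x). p (m (Id J i), x))"
  have code: "inj_on code U"
  proof (rule inj_onI)
    fix a b assume ab: "a \<in> U" "b \<in> U" "code a = code b"
    then obtain i x j y where [simp]: "a = (i, x)" "b = (j, y)" and ij: "i \<in> Ob J" "j \<in> Ob J"
      by (auto simp: U_def)
    have eq: "m (Id J i) = m (Id J j)" "x = y" using ab injD[OF p] by (auto simp: code_def)
    have "Id J i = Id J j" by (rule inj_onD[OF m eq(1) IdM[OF ij(1)] IdM[OF ij(2)]])
    from inj_onD[OF idi this ij] eq show "a = b" by simp
  qed
  have FM: "FMor F u = (FOb F (Dom J u), FOb F (Cod J u), ap u)" "ap u \<in> FOb F (Dom J u) \<rightarrow>\<^sub>E FOb F (Cod J u)"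
    if "u \<in> Mor J" for u
  proof -
    have "FMor F u \<in> hom ?S (FOb F (Dom J u)) (FOb F (Cod J u))"
      using F that by (simp add: is_functor_def)
    then show "FMor F u = (FOb F (Dom J u), FOb F (Cod J u), ap u)"
      "ap u \<in> FOb F (Dom J u) \<rightarrow>\<^sub>E FOb F (Cod J u)"
      by (auto simp: hom_set_cat ap_def)
  qed
  define r where "r = {((Dom J u, x), (Cod J u, ap u x)) | u x. u \<in> Mor J \<and> x \<in> FOb F (Dom J u)}"
  define R where "R = (r \<union> r\<inverse>)\<^sup>*"
  have eqR: "sym R" "trans R" "refl R" by (auto simp: R_def sym_rtrancl sym_Un_converse trans_rtrancl refl_rtrancl)
  have rU: "r \<subseteq> U \<times> U" using FM(2) J.Dom_in_Ob J.Cod_in_Ob by (fastforce simp: r_def U_def)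
  have RU: "b \<in> U" if "(a, b) \<in> R" "a \<in> U" for a b
    using that unfolding R_def by (induction rule: rtrancl_induct) (use rU in auto)
  define rep where "rep a = code (SOME b. (a, b) \<in> R)" for a
  have rep: "\<exists>b. (a, b) \<in> R \<and> rep a = code b" for a
    unfolding rep_def using someI_ex[of "\<lambda>b. (a, b) \<in> R"] eqR(3) by (blast dest: refl_onD)
  have repR: "rep a = rep b" if "(a, b) \<in> R" for a b
  proof -
    have "(\<lambda>c. (a, c) \<in> R) = (\<lambda>c. (b, c) \<in> R)" using that eqR by (blast elim: symE transE)
    then show ?thesis by (simp add: rep_def)
  qed
  define X where "X = rep ` U"
  define k where "k i = (FOb F i, X, \<lambda>x\<in>FOb F i. rep (i, x))" for i
  define e where "e = \<lparr>Src = F, Tgt = const_functor J ?S X, At = (\<lambda>i\<in>Ob J. k i)\<rparr>"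
  have Ate: "At e i = (FOb F i, X, \<lambda>x\<in>FOb F i. rep (i, x))" if "i \<in> Ob J" for i
    using that by (simp add: e_def k_def)
  have "cocone J ?S F X e"
    unfolding e_def
  proof (rule cocone_exI[OF J category_set_cat F])
    show "X \<in> Ob ?S" by (simp add: set_cat_def)
    show "k i \<in> hom ?S (FOb F i) X" if "i \<in> Ob J" for i
      using that by (auto simp: k_def hom_set_cat X_def U_def)
    fix u assume u: "u \<in> Mor J"
    have "rep (Dom J u, x) = rep (Cod J u, ap u x)" if "x \<in> FOb F (Dom J u)" for x
      by (rule repR) (use u that in \<open>auto simp: R_def r_def intro!: r_into_rtrancl\<close>)
    then show "Comp ?S (k (Cod J u)) (FMor F u) = k (Dom J u)"
      using FM[OF u] by (auto simp: k_def Comp_set_cat fun_eq_iff)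
  qed
  moreover have "\<exists>!h. h \<in> hom ?S X Y \<and> (\<forall>i\<in>Ob J. Comp ?S h (At e i) = At \<kappa> i)"
    if c: "cocone J ?S F Y \<kappa>" for Y \<kappa>
  proof -
    define v where "v i = snd (snd (At \<kappa> i))" for i
    have k: "At \<kappa> i = (FOb F i, Y, v i)" "v i \<in> FOb F i \<rightarrow>\<^sub>E Y" if "i \<in> Ob J" for i
      using coconeD[OF c that] by (auto simp: v_def hom_set_cat)
    have vn: "v (Cod J u) (ap u x) = v (Dom J u) x" if u: "u \<in> Mor J" "x \<in> FOb F (Dom J u)" for u x
    proof -
      have "(\<lambda>x\<in>FOb F (Dom J u). v (Cod J u) (ap u x)) = v (Dom J u)"
        using coconeD2[OF J category_set_cat c u(1)]
        by (simp add: k(1)[OF J.Dom_in_Ob[OF u(1)]] k(1)[OF J.Cod_in_Ob[OF u(1)]] FM(1)[OF u(1)]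
            Comp_set_cat)
      from fun_cong[OF this, of x] u(2) show ?thesis by simp
    qed
    have vR: "case_prod v a = case_prod v b" if "(a, b) \<in> R" for a b
      using that unfolding R_def
      by (induction rule: rtrancl_induct) (auto simp: r_def vn)
    define g where "g = (\<lambda>q\<in>X. case_prod v (inv_into U code q))"
    have g: "g (rep a) = case_prod v a" if "a \<in> U" for a
    proof -
      obtain b where b: "(a, b) \<in> R" "rep a = code b" using rep by blast
      have "b \<in> U" using RU b that by blast
      moreover have "code b \<in> X" unfolding X_def b(2)[symmetric] using that by (rule imageI)
      ultimately show ?thesis using vR[OF b(1)] code by (simp add: g_def b(2))
    qed
    show ?thesis
    proof (rule ex1I[of _ "(X, Y, g)"], intro conjI ballI)
      have "g (rep a) \<in> Y" if "a \<in> U" for a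
        using that g[OF that] k(2) by (auto simp: U_def)
      then show "(X, Y, g) \<in> hom ?S X Y"
        by (auto simp: hom_set_cat X_def g_def)
      fix i assume i: "i \<in> Ob J"
      have "(\<lambda>x\<in>FOb F i. g (rep (i, x))) = v i"
      proof
        fix x show "(\<lambda>x\<in>FOb F i. g (rep (i, x))) x = v i x"
          using g[of "(i, x)"] i PiE_arb[OF k(2)[OF i], of x] by (cases "x \<in> FOb F i") (simp_all add: U_def)
      qed
      then have "(\<lambda>y\<in>FOb F i. g ((\<lambda>x\<in>FOb F i. rep (i, x)) y)) = v i"
        by (simp cong: restrict_cong)
      then show "Comp ?S (X, Y, g) (At e i) = At \<kappa> i"
        by (simp add: k(1)[OF i] Ate[OF i] Comp_set_cat)
    next
      fix h assume h: "h \<in> hom ?S X Y \<and> (\<forall>i\<in>Ob J. Comp ?S h (At e i) = At \<kappa> i)"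
      then obtain h' where h': "h = (X, Y, h')" "h' \<in> X \<rightarrow>\<^sub>E Y" by (auto simp: hom_set_cat)
      have "h' (rep (i, x)) = v i x" if "i \<in> Ob J" "x \<in> FOb F i" for i x
      proof -
        have "Comp ?S h (At e i) = At \<kappa> i" using h that(1) by blast
        then have "(\<lambda>y\<in>FOb F i. h' ((\<lambda>x\<in>FOb F i. rep (i, x)) y)) = v i"
          unfolding h'(1) Ate[OF that(1)] k(1)[OF that(1)] Comp_set_cat by simp
        from fun_cong[OF this, of x] that(2) show ?thesis by simp
      qed
      then have "h' q = g q" if "q \<in> X" for q
        using g that by (auto simp: X_def U_def)
      then have "h' = g" using h'(2) by (intro extensionalityI[of _ X]) (auto simp: g_def PiE_iff)
      then show "h = (X, Y, g)" using h'(1) by simp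
    qed
  qed
  ultimately show ?thesis unfolding colimit_cocone_def by blast
qed

theorem set_cat_colimit_functor_exists:
  fixes J :: "('o, 'm) cat"
  assumes "category J" "infinite (UNIV :: 'u set)" "Mor J \<lesssim> (UNIV :: 'u set)"
  shows "\<exists>L \<eta>. colimit_functor J (set_cat :: ('u set, 'u set \<times> 'u set \<times> ('u \<Rightarrow> 'u)) cat) L \<eta>"
  using assms category_set_cat set_cat_colimit_exists by (intro colimit_functor_exists)

end

theory Submission
  imports Defs
begin

text \<open>
  By the Yoneda lemma, monomorphisms and pullbacks of set-valued diagrams are computed pointwise.
  If \<open>I\<close> is confluent, two elements of a diagram become equal in the colimit iff some pair of arrows
  with a common codomain sends them to the same element, and the pullback property passes to the
  colimit by a diagram chase; injectivity of the monic leg gives uniqueness.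

  Conversely, let \<open>a : c \<rightarrow> d\<close> and \<open>b : c \<rightarrow> e\<close>. Inside \<open>hom(c, -)\<close> let \<open>B\<close> be the subfunctor of
  the arrows that factor through \<open>b\<close>, and let \<open>P\<close> be its inverse image along
  \<open>a\<^sup>* : hom(d, -) \<rightarrow> hom(c, -)\<close>. All elements of \<open>hom(c, -)\<close> are identified in the colimit, so
  \<open>colim P\<close>, being the pullback of the nonempty sets \<open>colim hom(d, -)\<close> and \<open>colim B\<close> over a
  point, is nonempty. Hence some \<open>P j\<close> is nonempty, and its elements complete the span \<open>a\<close>, \<open>b\<close> to
  a commutative square.
\<close>

section \<open>Set-valued functors in terms of elements\<close>

type_synonym 'u smap = "'u set \<times> 'u set \<times> ('u \<Rightarrow> 'u)"
type_synonym ('o, 'm, 'u) diagram = "('o, 'm, 'u set, 'u smap) fctr"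
type_synonym ('o, 'm, 'u) diagram_map = "('o, 'm, 'u set, 'u smap) nat_trans"

definition app :: "'u smap \<Rightarrow> 'u \<Rightarrow> 'u" where
  "app h = snd (snd h)"

lemma app_simp [simp]: "app (A, B, f) = f"
  by (simp add: app_def)

abbreviation act :: "('o, 'm, 'u) diagram \<Rightarrow> 'm \<Rightarrow> 'u \<Rightarrow> 'u" where
  "act F u \<equiv> app (FMor F u)"

abbreviation component :: "('o, 'm, 'u) diagram_map \<Rightarrow> 'o \<Rightarrow> 'u \<Rightarrow> 'u" where
  "component t i \<equiv> app (At t i)"

lemma hom_set_catD:
  assumes "h \<in> hom set_cat A B"
  shows "h = (A, B, app h)" "app h \<in> A \<rightarrow>\<^sub>E B"
  using assms by (auto simp: hom_set_cat)

lemma app_in: "h \<in> hom set_cat A B \<Longrightarrow> x \<in> A \<Longrightarrow> app h x \<in> B"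
  using hom_set_catD(2) by blast

lemma app_Comp:
  assumes "h \<in> hom set_cat A B" "g \<in> hom set_cat B C" "x \<in> A"
  shows "app (Comp set_cat g h) x = app g (app h x)"
  using assms by (auto simp: hom_set_cat Comp_set_cat)

lemma hom_set_cat_eqI:
  assumes "h \<in> hom set_cat A B" "g \<in> hom set_cat A B" "\<And>x. x \<in> A \<Longrightarrow> app h x = app g x"
  shows "h = g"
proof -
  note h = hom_set_catD[OF assms(1)] and g = hom_set_catD[OF assms(2)]
  have "app h = app g" by (rule PiE_ext[OF h(2) g(2) assms(3)])
  with h(1) g(1) show ?thesis by metis
qed

text \<open>Only the universal half of a pullback: commutativity of the square is kept apart, as an
  equation between composites.\<close>

definition elementwise_pullback ::
  "'u set \<Rightarrow> 'u set \<Rightarrow> 'u set \<Rightarrow> ('u \<Rightarrow> 'u) \<Rightarrow> ('u \<Rightarrow> 'u) \<Rightarrow> ('u \<Rightarrow> 'u) \<Rightarrow> ('u \<Rightarrow> 'u) \<Rightarrow> bool" where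
  "elementwise_pullback P A B p q f g \<longleftrightarrow>
    (\<forall>x\<in>A. \<forall>y\<in>B. f x = g y \<longrightarrow> (\<exists>!z. z \<in> P \<and> p z = x \<and> q z = y))"

lemma elementwise_pullbackD:
  assumes "elementwise_pullback P A B p q f g" "x \<in> A" "y \<in> B" "f x = g y"
  shows "\<exists>!z. z \<in> P \<and> p z = x \<and> q z = y"
  using assms by (auto simp: elementwise_pullback_def)

section \<open>Pullback squares of sets\<close>

lemma pullback_squareD:
  assumes pb: "pullback_square C p q f g"
    and p: "p \<in> hom C P A" and f: "f \<in> hom C A G" and g: "g \<in> hom C B G"
    and x: "x \<in> hom C Z A" and y: "y \<in> hom C Z B" and e: "Comp C f x = Comp C g y"
  shows "\<exists>!h. h \<in> hom C Z P \<and> Comp C p h = x \<and> Comp C q h = y"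
proof -
  have D: "x \<in> Mor C" "y \<in> Mor C" "Dom C x = Z" "Dom C y = Z" "Cod C x = A" "Cod C y = B"
    "Dom C p = P" "Dom C f = A" "Dom C g = B"
    using assms by (auto simp: hom_def)
  have "\<forall>x\<in>Mor C. \<forall>y\<in>Mor C.
      Dom C x = Dom C y \<and> Cod C x = Dom C f \<and> Cod C y = Dom C g \<and> Comp C f x = Comp C g y \<longrightarrow>
      (\<exists>!h. h \<in> hom C (Dom C x) (Dom C p) \<and> Comp C p h = x \<and> Comp C q h = y)"
    using pb unfolding pullback_square_def by blast
  from bspec[OF bspec[OF this D(1)] D(2)] e show ?thesis unfolding D by simp
qed

text \<open>Elements of a set are maps from a one-element set. Testing the universal property on
  such maps gives the elementwise form; conversely, unique existence at each point determines the
  mediating map.\<close>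

lemma pullback_square_set_cat:
  assumes p: "p \<in> hom set_cat P A" and q: "q \<in> hom set_cat P B"
    and f: "f \<in> hom set_cat A C" and g: "g \<in> hom set_cat B C"
  shows "pullback_square set_cat p q f g \<longleftrightarrow>
    Comp set_cat f p = Comp set_cat g q \<and>
    elementwise_pullback P A B (app p) (app q) (app f) (app g)"
proof -
  interpret S: category set_cat by (rule category_set_cat)
  have D: "p \<in> Mor set_cat" "q \<in> Mor set_cat" "f \<in> Mor set_cat" "g \<in> Mor set_cat"
    "Dom set_cat p = P" "Dom set_cat q = P" "Dom set_cat f = A" "Dom set_cat g = B"
    "Cod set_cat p = A" "Cod set_cat q = B" "Cod set_cat f = C" "Cod set_cat g = C"
    using assms by (auto simp: hom_def)
  have "elementwise_pullback P A B (app p) (app q) (app f) (app g)"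
    if pb: "pullback_square set_cat p q f g"
    unfolding elementwise_pullback_def
  proof (intro ballI impI)
    fix x y assume x: "x \<in> A" and y: "y \<in> B" and e: "app f x = app g y"
    \<comment> \<open>The map from a one-element set that picks out \<open>z\<close>. The set is
      \<open>{x}\<close> for both legs, so that the two maps share their domain.\<close>
    define k where "k B z = ({x}, B, \<lambda>_\<in>{x}. z)" for B :: "'a set" and z :: 'a
    have k: "k B z \<in> hom set_cat {x} B" "app (k B z) x = z" if "z \<in> B" for z B
      using that by (auto simp: k_def hom_set_cat)
    have "Comp set_cat f (k A x) = Comp set_cat g (k B y)"
      using S.Comp_in_hom[OF k(1)[OF x] f] S.Comp_in_hom[OF k(1)[OF y] g]
      by (rule hom_set_cat_eqI)
        (use e in \<open>simp add: app_Comp[OF k(1)[OF x] f] app_Comp[OF k(1)[OF y] g] k(2) x y\<close>)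
    then have ex: "\<exists>!h. h \<in> hom set_cat {x} P \<and> Comp set_cat p h = k A x \<and> Comp set_cat q h = k B y"
      by (rule pullback_squareD[OF pb p f g k(1)[OF x] k(1)[OF y]])
    then obtain h where h: "h \<in> hom set_cat {x} P" "Comp set_cat p h = k A x" "Comp set_cat q h = k B y"
      by blast
    show "\<exists>!z. z \<in> P \<and> app p z = x \<and> app q z = y"
    proof (rule ex1I[of _ "app h x"])
      show "app h x \<in> P \<and> app p (app h x) = x \<and> app q (app h x) = y"
        using app_in[OF h(1), of x] app_Comp[OF h(1) p, of x] app_Comp[OF h(1) q, of x] h(2,3) k(2) x y
        by auto
      fix z assume z: "z \<in> P \<and> app p z = x \<and> app q z = y"
      note kz = k[OF conjunct1[OF z]]
      have "Comp set_cat p (k P z) = k A x"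
        using S.Comp_in_hom[OF kz(1) p] k(1)[OF x]
        by (rule hom_set_cat_eqI) (use z k x in \<open>simp add: app_Comp[OF kz(1) p] kz\<close>)
      moreover have "Comp set_cat q (k P z) = k B y"
        using S.Comp_in_hom[OF kz(1) q] k(1)[OF y]
        by (rule hom_set_cat_eqI) (use z k y in \<open>simp add: app_Comp[OF kz(1) q] kz\<close>)
      ultimately have "k P z = h" using ex h kz(1) by blast
      then show "z = app h x" using kz(2) by simp
    qed
  qed
  moreover have "pullback_square set_cat p q f g"
    if c: "Comp set_cat f p = Comp set_cat g q"
      and pb: "elementwise_pullback P A B (app p) (app q) (app f) (app g)"
    unfolding pullback_square_def D
  proof (intro conjI ballI impI D c refl)
    fix x y assume "x \<in> Mor set_cat" "y \<in> Mor set_cat"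
      and xy: "Dom set_cat x = Dom set_cat y \<and> Cod set_cat x = A \<and> Cod set_cat y = B \<and>
        Comp set_cat f x = Comp set_cat g y"
    then obtain Z where x: "x \<in> hom set_cat Z A" and y: "y \<in> hom set_cat Z B"
      and Z: "Dom set_cat x = Z"
      by (auto simp: hom_def)
    have e: "app f (app x z) = app g (app y z)" if "z \<in> Z" for z
      using xy app_Comp[OF x f that] app_Comp[OF y g that] by simp
    have ex: "\<exists>!w. w \<in> P \<and> app p w = app x z \<and> app q w = app y z" if "z \<in> Z" for z
      by (rule elementwise_pullbackD[OF pb app_in[OF x that] app_in[OF y that] e[OF that]])
    define k where "k z = (THE w. w \<in> P \<and> app p w = app x z \<and> app q w = app y z)" for z
    have k: "k z \<in> P" "app p (k z) = app x z" "app q (k z) = app y z" if "z \<in> Z" for z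
      using theI'[OF ex[OF that]] by (simp_all add: k_def)
    define h where "h = (Z, P, \<lambda>z\<in>Z. k z)"
    have h: "h \<in> hom set_cat Z P" using k(1) by (auto simp: h_def hom_set_cat)
    have ha: "app h z = k z" if "z \<in> Z" for z using that by (simp add: h_def)
    show "\<exists>!h. h \<in> hom set_cat (Dom set_cat x) P \<and> Comp set_cat p h = x \<and> Comp set_cat q h = y"
      unfolding Z
    proof (rule ex1I[of _ h], intro conjI)
      show "h \<in> hom set_cat Z P" by (rule h)
      show "Comp set_cat p h = x"
        using S.Comp_in_hom[OF h p] x by (rule hom_set_cat_eqI) (simp add: app_Comp[OF h p] ha k)
      show "Comp set_cat q h = y"
        using S.Comp_in_hom[OF h q] y by (rule hom_set_cat_eqI) (simp add: app_Comp[OF h q] ha k)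
      fix h' assume h': "h' \<in> hom set_cat Z P \<and> Comp set_cat p h' = x \<and> Comp set_cat q h' = y"
      show "h' = h"
        using conjunct1[OF h'] h
      proof (rule hom_set_cat_eqI)
        fix z assume z: "z \<in> Z"
        have "app h' z \<in> P \<and> app p (app h' z) = app x z \<and> app q (app h' z) = app y z"
          using h' z app_in[OF conjunct1[OF h'] z] app_Comp[OF conjunct1[OF h'] p z]
            app_Comp[OF conjunct1[OF h'] q z] by auto
        with ex[OF z] k[OF z] show "app h' z = app h z" unfolding ha[OF z] by blast
      qed
    qed
  qed
  ultimately show ?thesis unfolding pullback_square_def by blast
qed

section \<open>Functor categories and set-valued diagrams built from raw data\<close>

lemma functor_cat_simps [simp]:
  "Ob (functor_cat C D) = {F. is_functor C D F}"
  "Mor (functor_cat C D) = {t. is_nat_trans C D t}"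
  "Dom (functor_cat C D) = Src"
  "Cod (functor_cat C D) = Tgt"
  by (simp_all add: functor_cat_def)

lemma hom_functor_cat:
  "t \<in> hom (functor_cat C D) F G \<longleftrightarrow> is_nat_trans C D t \<and> Src t = F \<and> Tgt t = G"
  by (simp add: hom_def)

lemma Comp_functor_cat_simps:
  "Src (Comp (functor_cat C D) s t) = Src t"
  "Tgt (Comp (functor_cat C D) s t) = Tgt s"
  "i \<in> Ob C \<Longrightarrow> At (Comp (functor_cat C D) s t) i = Comp D (At s i) (At t i)"
  by (simp_all add: functor_cat_def)

context category
begin

lemma FMor_in_hom:
  "is_functor C D F \<Longrightarrow> u \<in> hom C i j \<Longrightarrow> FMor F u \<in> hom D (FOb F i) (FOb F j)"
  by (auto simp: is_functor_def hom_def)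

lemma FMor_Comp:
  assumes "is_functor C D F" "u \<in> hom C i j" "v \<in> hom C j k"
  shows "FMor F (Comp C v u) = Comp D (FMor F v) (FMor F u)"
  using assms by (simp add: is_functor_def hom_def)

lemma act_in:
  "is_functor C set_cat F \<Longrightarrow> u \<in> hom C i j \<Longrightarrow> x \<in> FOb F i \<Longrightarrow> act F u x \<in> FOb F j"
  by (rule app_in[OF FMor_in_hom])

lemma act_Id:
  assumes "is_functor C set_cat F" "i \<in> Ob C" "x \<in> FOb F i"
  shows "act F (Id C i) x = x"
proof -
  have "FMor F (Id C i) = Id set_cat (FOb F i)" using assms by (simp add: is_functor_def)
  then show ?thesis using assms(3) by (simp add: set_cat_def)
qed

lemma act_Comp:
  assumes "is_functor C set_cat F" "u \<in> hom C i j" "v \<in> hom C j k" "x \<in> FOb F i"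
  shows "act F (Comp C v u) x = act F v (act F u x)"
  using FMor_Comp[OF assms(1-3)]
    app_Comp[OF FMor_in_hom[OF assms(1,2)] FMor_in_hom[OF assms(1,3)] assms(4)] by simp

text \<open>The restrictions to \<open>Ob C\<close>, \<open>Mor C\<close> and
  \<open>X (Dom C u)\<close> make the result extensional, so \<open>X\<close> and \<open>r\<close>
  may take arbitrary values elsewhere.\<close>

definition set_functor :: "('o \<Rightarrow> 'u set) \<Rightarrow> ('m \<Rightarrow> 'u \<Rightarrow> 'u) \<Rightarrow> ('o, 'm, 'u) diagram" where
  "set_functor X r =
    \<lparr>FOb = (\<lambda>i\<in>Ob C. X i), FMor = (\<lambda>u\<in>Mor C. (X (Dom C u), X (Cod C u), \<lambda>x\<in>X (Dom C u). r u x))\<rparr>"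

lemma FOb_set_functor: "i \<in> Ob C \<Longrightarrow> FOb (set_functor X r) i = X i"
  by (simp add: set_functor_def)

lemma act_set_functor: "u \<in> hom C i j \<Longrightarrow> x \<in> X i \<Longrightarrow> act (set_functor X r) u x = r u x"
  by (auto simp: set_functor_def hom_def)

lemma is_functor_set_functor:
  assumes r: "\<And>u i j x. u \<in> hom C i j \<Longrightarrow> x \<in> X i \<Longrightarrow> r u x \<in> X j"
    and r_Id: "\<And>i x. i \<in> Ob C \<Longrightarrow> x \<in> X i \<Longrightarrow> r (Id C i) x = x"
    and r_Comp: "\<And>u v i j k x. u \<in> hom C i j \<Longrightarrow> v \<in> hom C j k \<Longrightarrow> x \<in> X i \<Longrightarrow>
      r (Comp C v u) x = r v (r u x)"
  shows "is_functor C set_cat (set_functor X r)"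
proof -
  have m: "u \<in> hom C (Dom C u) (Cod C u)" if "u \<in> Mor C" for u using that by (simp add: hom_def)
  have Id: "Id C a \<in> Mor C" "Dom C (Id C a) = a" "Cod C (Id C a) = a" if "a \<in> Ob C" for a
    using Id_in_hom[OF that] by (auto simp: hom_def)
  show ?thesis
    unfolding is_functor_def
  proof (intro conjI ballI impI)
    show "FOb (set_functor X r) \<in> Ob C \<rightarrow>\<^sub>E Ob set_cat"
      by (auto simp: set_functor_def set_cat_def)
    show "FMor (set_functor X r) \<in> Mor C \<rightarrow>\<^sub>E Mor set_cat"
      using r[OF m] by (auto simp: set_functor_def set_cat_def)
    fix u assume u: "u \<in> Mor C"
    show "FMor (set_functor X r) u \<in>
      hom set_cat (FOb (set_functor X r) (Dom C u)) (FOb (set_functor X r) (Cod C u))"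
      using r[OF m] u Dom_in_Ob Cod_in_Ob by (auto simp: set_functor_def hom_set_cat)
    fix v assume v: "v \<in> Mor C" and uv: "Cod C u = Dom C v"
    have h: "u \<in> hom C (Dom C u) (Dom C v)" "v \<in> hom C (Dom C v) (Cod C v)"
      using u v uv by (auto simp: hom_def)
    have vu: "Comp C v u \<in> Mor C" "Dom C (Comp C v u) = Dom C u" "Cod C (Comp C v u) = Cod C v"
      using Comp_in_hom[OF h] by (auto simp: hom_def)
    show "FMor (set_functor X r) (Comp C v u) =
      Comp set_cat (FMor (set_functor X r) v) (FMor (set_functor X r) u)"
      using u v vu uv r[OF h(1)] r_Comp[OF h]
      by (auto simp: set_functor_def Comp_set_cat intro!: restrict_ext)
  next
    fix a assume "a \<in> Ob C"
    then show "FMor (set_functor X r) (Id C a) = Id set_cat (FOb (set_functor X r) a)"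
      using r_Id by (auto simp: set_functor_def set_cat_def Id intro!: restrict_ext)
  qed
qed

lemma component_in_hom:
  "t \<in> hom (functor_cat C D) F G \<Longrightarrow> i \<in> Ob C \<Longrightarrow> At t i \<in> hom D (FOb F i) (FOb G i)"
  by (auto simp: hom_functor_cat is_nat_trans_def)

lemma component_in:
  assumes "t \<in> hom (functor_cat C set_cat) F G" "i \<in> Ob C" "x \<in> FOb F i"
  shows "component t i x \<in> FOb G i"
  by (rule app_in[OF component_in_hom[OF assms(1,2)] assms(3)])

lemma hom_functor_catD:
  assumes "t \<in> hom (functor_cat C D) F G"
  shows "is_functor C D F" "is_functor C D G"
  using assms by (auto simp: hom_functor_cat is_nat_trans_def)

lemma naturality:
  assumes t: "t \<in> hom (functor_cat C set_cat) F G" and u: "u \<in> hom C i j" and x: "x \<in> FOb F i"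
  shows "component t j (act F u x) = act G u (component t i x)"
proof -
  have ij: "i \<in> Ob C" "j \<in> Ob C" using u Dom_in_Ob Cod_in_Ob by (auto simp: hom_def)
  note h = component_in_hom[OF t ij(1)] component_in_hom[OF t ij(2)]
  have "Comp set_cat (At t j) (FMor F u) = Comp set_cat (FMor G u) (At t i)"
    using t u by (auto simp: hom_functor_cat is_nat_trans_def hom_def)
  then show ?thesis
    using app_Comp[OF FMor_in_hom[OF hom_functor_catD(1)[OF t] u] h(2) x]
      app_Comp[OF h(1) FMor_in_hom[OF hom_functor_catD(2)[OF t] u] x] by simp
qed

lemma component_Comp:
  assumes "t \<in> hom (functor_cat C set_cat) F G" "s \<in> hom (functor_cat C set_cat) G H"
    and "i \<in> Ob C" "x \<in> FOb F i"
  shows "component (Comp (functor_cat C set_cat) s t) i x = component s i (component t i x)"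
  using app_Comp[OF component_in_hom[OF assms(1,3)] component_in_hom[OF assms(2,3)] assms(4)] assms(3)
  by (simp add: Comp_functor_cat_simps)

lemma nat_trans_eqI:
  assumes t: "t \<in> hom (functor_cat C set_cat) F G" and s: "s \<in> hom (functor_cat C set_cat) F G"
    and e: "\<And>i x. i \<in> Ob C \<Longrightarrow> x \<in> FOb F i \<Longrightarrow> component t i x = component s i x"
  shows "t = s"
proof -
  have "At t = At s"
  proof (rule extensionalityI[of _ "Ob C"])
    show "At t \<in> extensional (Ob C)" "At s \<in> extensional (Ob C)"
      using t s by (auto simp: hom_functor_cat is_nat_trans_def PiE_iff)
    fix i assume i: "i \<in> Ob C"
    show "At t i = At s i"
      by (rule hom_set_cat_eqI[OF component_in_hom[OF t i] component_in_hom[OF s i] e[OF i]])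
  qed
  then show ?thesis using t s by (auto simp: hom_functor_cat intro: nat_trans.equality)
qed

definition set_nat_trans :: "('o, 'm, 'u) diagram \<Rightarrow> ('o, 'm, 'u) diagram \<Rightarrow>
    ('o \<Rightarrow> 'u \<Rightarrow> 'u) \<Rightarrow> ('o, 'm, 'u) diagram_map" where
  "set_nat_trans F G k =
    \<lparr>Src = F, Tgt = G, At = (\<lambda>i\<in>Ob C. (FOb F i, FOb G i, \<lambda>x\<in>FOb F i. k i x))\<rparr>"

lemma component_set_nat_trans:
  "i \<in> Ob C \<Longrightarrow> x \<in> FOb F i \<Longrightarrow> component (set_nat_trans F G k) i x = k i x"
  by (simp add: set_nat_trans_def)

lemma set_nat_trans_in_hom:
  assumes F: "is_functor C set_cat F" and G: "is_functor C set_cat G"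
    and k: "\<And>i x. i \<in> Ob C \<Longrightarrow> x \<in> FOb F i \<Longrightarrow> k i x \<in> FOb G i"
    and n: "\<And>u i j x. u \<in> hom C i j \<Longrightarrow> x \<in> FOb F i \<Longrightarrow> k j (act F u x) = act G u (k i x)"
  shows "set_nat_trans F G k \<in> hom (functor_cat C set_cat) F G"
proof -
  interpret S: category set_cat by (rule category_set_cat)
  let ?t = "set_nat_trans F G k"
  have a: "At ?t i \<in> hom set_cat (FOb F i) (FOb G i)" if "i \<in> Ob C" for i
    using that k by (auto simp: set_nat_trans_def hom_set_cat)
  have "Comp set_cat (At ?t (Cod C u)) (FMor F u) = Comp set_cat (FMor G u) (At ?t (Dom C u))"
    if "u \<in> Mor C" for u
  proof -
    have u: "u \<in> hom C (Dom C u) (Cod C u)" using that by (simp add: hom_def)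
    note ij = Dom_in_Ob[OF that] Cod_in_Ob[OF that]
    note h = FMor_in_hom[OF F u] a[OF ij(2)] a[OF ij(1)] FMor_in_hom[OF G u]
    show ?thesis
      by (rule hom_set_cat_eqI[OF S.Comp_in_hom[OF h(1,2)] S.Comp_in_hom[OF h(3,4)]])
        (simp add: app_Comp[OF h(1,2)] app_Comp[OF h(3,4)] component_set_nat_trans ij
          act_in[OF F u] n[OF u])
  qed
  then show ?thesis
    using a F G by (auto simp: hom_functor_cat is_nat_trans_def set_nat_trans_def)
qed

section \<open>Pointwise criteria for monomorphisms and pullbacks of diagrams\<close>

lemma monic_functor_catI:
  assumes m: "m \<in> hom (functor_cat C set_cat) B G"
    and inj: "\<And>i. i \<in> Ob C \<Longrightarrow> inj_on (component m i) (FOb B i)"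
  shows "monic (functor_cat C set_cat) m"
  unfolding monic_def
proof (intro conjI ballI impI)
  show "m \<in> Mor (functor_cat C set_cat)" using m by (simp add: hom_def)
  fix x y
  assume "x \<in> Mor (functor_cat C set_cat)" "y \<in> Mor (functor_cat C set_cat)"
    and xy: "Dom (functor_cat C set_cat) x = Dom (functor_cat C set_cat) y \<and>
      Cod (functor_cat C set_cat) x = Dom (functor_cat C set_cat) m \<and>
      Cod (functor_cat C set_cat) y = Dom (functor_cat C set_cat) m \<and>
      Comp (functor_cat C set_cat) m x = Comp (functor_cat C set_cat) m y"
  then have x: "x \<in> hom (functor_cat C set_cat) (Src x) B"
    and y: "y \<in> hom (functor_cat C set_cat) (Src x) B"
    using m by (simp_all add: hom_functor_cat)
  show "x = y"
  proof (rule nat_trans_eqI[OF x y])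
    fix i z assume i: "i \<in> Ob C" and z: "z \<in> FOb (Src x) i"
    show "component x i z = component y i z"
    proof (rule inj_onD[OF inj[OF i] _ component_in[OF x i z] component_in[OF y i z]])
      show "component m i (component x i z) = component m i (component y i z)"
        using component_Comp[OF x m i z] component_Comp[OF y m i z] xy by simp
    qed
  qed
qed

text \<open>Unique existence at each object and element determines the components of the mediating
  transformation; their naturality is itself a consequence of uniqueness.\<close>

lemma pullback_square_functor_catI:
  assumes p: "p \<in> hom (functor_cat C set_cat) P A" and q: "q \<in> hom (functor_cat C set_cat) P B"
    and f: "f \<in> hom (functor_cat C set_cat) A G" and g: "g \<in> hom (functor_cat C set_cat) B G"
    and c: "Comp (functor_cat C set_cat) f p = Comp (functor_cat C set_cat) g q"
    and pb: "\<And>i. i \<in> Ob C \<Longrightarrow> elementwise_pullback (FOb P i) (FOb A i) (FOb B i)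
      (component p i) (component q i) (component f i) (component g i)"
  shows "pullback_square (functor_cat C set_cat) p q f g"
proof -
  let ?D = "functor_cat C set_cat"
  interpret D: category ?D by (intro category_functor_cat category_axioms category_set_cat)
  have D: "Dom ?D p = P" "Dom ?D q = P" "Dom ?D f = A" "Dom ?D g = B"
    "Cod ?D p = A" "Cod ?D q = B" "Cod ?D f = G" "Cod ?D g = G"
    "p \<in> Mor ?D" "q \<in> Mor ?D" "f \<in> Mor ?D" "g \<in> Mor ?D"
    using p q f g by (auto simp: hom_def)
  show ?thesis
    unfolding pullback_square_def D
  proof (intro conjI ballI impI D c refl)
    fix x y assume "x \<in> Mor ?D" "y \<in> Mor ?D"
      and xy: "Dom ?D x = Dom ?D y \<and> Cod ?D x = A \<and> Cod ?D y = B \<and> Comp ?D f x = Comp ?D g y"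
    then obtain Z where x: "x \<in> hom ?D Z A" and y: "y \<in> hom ?D Z B" and Z: "Dom ?D x = Z"
      by (simp add: hom_def)
    let ?w = "\<lambda>i z w. w \<in> FOb P i \<and> component p i w = component x i z \<and> component q i w = component y i z"
    have e: "component f i (component x i z) = component g i (component y i z)"
      if "i \<in> Ob C" "z \<in> FOb Z i" for i z
      using xy component_Comp[OF x f that] component_Comp[OF y g that] by simp
    have ex: "\<exists>!w. ?w i z w" if "i \<in> Ob C" "z \<in> FOb Z i" for i z
      by (rule elementwise_pullbackD[OF pb[OF that(1)] component_in[OF x that] component_in[OF y that] e[OF that]])
    define k where "k i z = (THE w. ?w i z w)" for i z
    have k: "?w i z (k i z)" if "i \<in> Ob C" "z \<in> FOb Z i" for i z
      using theI'[OF ex[OF that]] by (simp add: k_def)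
    have k_eq: "w = k i z" if "i \<in> Ob C" "z \<in> FOb Z i" "?w i z w" for i z w
      using ex[OF that(1,2)] k[OF that(1,2)] that(3) by blast
    define h where "h = set_nat_trans Z P k"
    have h: "h \<in> hom ?D Z P"
      unfolding h_def
    proof (rule set_nat_trans_in_hom[OF hom_functor_catD(1)[OF x] hom_functor_catD(1)[OF p]])
      show "k i z \<in> FOb P i" if "i \<in> Ob C" "z \<in> FOb Z i" for i z using k[OF that] by blast
      fix u i j z assume u: "u \<in> hom C i j" and z: "z \<in> FOb Z i"
      have ij: "i \<in> Ob C" "j \<in> Ob C" using u Dom_in_Ob Cod_in_Ob by (auto simp: hom_def)
      note kz = k[OF ij(1) z]
      \<comment> \<open>By naturality of \<open>p\<close>, \<open>q\<close>, \<open>x\<close> and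
        \<open>y\<close>, the element \<open>act P u (k i z)\<close> has the two projections that
        characterise \<open>k j (act Z u z)\<close>, so uniqueness identifies them.\<close>
      have "?w j (act Z u z) (act P u (k i z))"
        using kz naturality[OF p u, of "k i z"] naturality[OF q u, of "k i z"] naturality[OF x u z]
          naturality[OF y u z] act_in[OF hom_functor_catD(1)[OF p] u, of "k i z"] by simp
      from k_eq[OF ij(2) act_in[OF hom_functor_catD(1)[OF x] u z] this]
      show "k j (act Z u z) = act P u (k i z)" by simp
    qed
    have ha: "component h i z = k i z" if "i \<in> Ob C" "z \<in> FOb Z i" for i z
      using that by (simp add: h_def component_set_nat_trans)
    show "\<exists>!h. h \<in> hom ?D (Dom ?D x) P \<and> Comp ?D p h = x \<and> Comp ?D q h = y"
      unfolding Z
    proof (rule ex1I[of _ h], intro conjI)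
      show "h \<in> hom ?D Z P" by (rule h)
      show "Comp ?D p h = x"
        by (rule nat_trans_eqI[OF D.Comp_in_hom[OF h p] x]) (simp add: component_Comp[OF h p] ha k)
      show "Comp ?D q h = y"
        by (rule nat_trans_eqI[OF D.Comp_in_hom[OF h q] y]) (simp add: component_Comp[OF h q] ha k)
      fix h' assume "h' \<in> hom ?D Z P \<and> Comp ?D p h' = x \<and> Comp ?D q h' = y"
      then have h': "h' \<in> hom ?D Z P" "Comp ?D p h' = x" "Comp ?D q h' = y" by auto
      show "h' = h"
      proof (rule nat_trans_eqI[OF h'(1) h])
        fix i z assume i: "i \<in> Ob C" and z: "z \<in> FOb Z i"
        have "?w i z (component h' i z)"
          using component_in[OF h'(1) i z] component_Comp[OF h'(1) p i z]
            component_Comp[OF h'(1) q i z] h'(2,3) by simp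
        from k_eq[OF i z this] show "component h' i z = component h i z"
          by (simp add: ha[OF i z])
      qed
    qed
  qed
qed

end


section \<open>Representable functors and the Yoneda lemma\<close>

text \<open>The injection \<open>enc\<close> moves hom-sets into the universe, so that representable
  functors become diagrams of subsets of \<open>'u\<close>. Infinity of \<open>'u\<close> enters in
  the existence of colimit functors and in the choice of two distinct points.\<close>

locale small_category = category C for C :: "('o, 'm) cat" +
  fixes enc :: "'m \<Rightarrow> 'u"
  assumes inj_enc: "inj_on enc (Mor C)"
    and infinite_UNIV: "infinite (UNIV :: 'u set)"
begin

definition dec :: "'u \<Rightarrow> 'm" where
  "dec = inv_into (Mor C) enc"

lemma dec_enc [simp]: "g \<in> hom C i j \<Longrightarrow> dec (enc g) = g"
  using inj_enc by (simp add: dec_def hom_def)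

text \<open>
  Meaningful only if \<open>S\<close> is a cosieve: then it is a subfunctor of \<open>hom(c, -)\<close>, moved into the
  universe \<open>'u\<close> along \<open>enc\<close>.
\<close>

definition subrep :: "'o \<Rightarrow> ('m \<Rightarrow> bool) \<Rightarrow> ('o, 'm, 'u) diagram" where
  "subrep c S = set_functor (\<lambda>i. enc ` {g \<in> hom C c i. S g}) (\<lambda>u x. enc (Comp C u (dec x)))"

definition cosieve :: "'o \<Rightarrow> ('m \<Rightarrow> bool) \<Rightarrow> bool" where
  "cosieve c S \<longleftrightarrow> (\<forall>i j. \<forall>g\<in>hom C c i. \<forall>u\<in>hom C i j. S g \<longrightarrow> S (Comp C u g))"

lemma FOb_subrep: "i \<in> Ob C \<Longrightarrow> FOb (subrep c S) i = enc ` {g \<in> hom C c i. S g}"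
  by (simp add: subrep_def FOb_set_functor)

lemma act_subrep:
  "g \<in> hom C c i \<Longrightarrow> S g \<Longrightarrow> u \<in> hom C i j \<Longrightarrow> act (subrep c S) u (enc g) = enc (Comp C u g)"
  by (auto simp: subrep_def act_set_functor)

lemma is_functor_subrep:
  assumes "cosieve c S"
  shows "is_functor C set_cat (subrep c S)"
  unfolding subrep_def
proof (rule is_functor_set_functor)
  fix u i j x assume u: "u \<in> hom C i j" and "x \<in> enc ` {g \<in> hom C c i. S g}"
  then obtain g where g: "x = enc g" "g \<in> hom C c i" "S g" by blast
  then show "enc (Comp C u (dec x)) \<in> enc ` {g \<in> hom C c j. S g}"
    using Comp_in_hom[OF g(2) u] assms u by (auto simp: cosieve_def)
  fix v k assume v: "v \<in> hom C j k"
  show "enc (Comp C (Comp C v u) (dec x)) = enc (Comp C v (dec (enc (Comp C u (dec x)))))"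
    using g Comp_in_hom[OF g(2) u] Comp_assoc[OF g(2) u v] by simp
next
  fix i x assume "x \<in> enc ` {g \<in> hom C c i. S g}"
  then show "enc (Comp C (Id C i) (dec x)) = x" by (auto simp: Comp_Id_left)
qed

text \<open>For \<open>a\<close> from \<open>c\<close> to \<open>d\<close> this is the map from
  hom(d, -) to hom(c, -) induced by \<open>a\<close>, cut down to the subfunctors \<open>S\<close>
  and \<open>T\<close>. With \<open>a\<close> an identity it is an inclusion of subfunctors.\<close>

definition precomp :: "'m \<Rightarrow> 'o \<Rightarrow> ('m \<Rightarrow> bool) \<Rightarrow> 'o \<Rightarrow> ('m \<Rightarrow> bool) \<Rightarrow>
    ('o, 'm, 'u) diagram_map" where
  "precomp a d S c T = set_nat_trans (subrep d S) (subrep c T) (\<lambda>i x. enc (Comp C (dec x) a))"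

lemma component_precomp:
  assumes "g \<in> hom C d i" "S g"
  shows "component (precomp a d S c T) i (enc g) = enc (Comp C g a)"
proof -
  have "i \<in> Ob C" using assms(1) Cod_in_Ob by (auto simp: hom_def)
  then show ?thesis
    using assms by (auto simp: precomp_def component_set_nat_trans FOb_subrep)
qed

lemma precomp_in_hom:
  assumes S: "cosieve d S" and T: "cosieve c T" and a: "a \<in> hom C c d"
    and ST: "\<And>g i. g \<in> hom C d i \<Longrightarrow> S g \<Longrightarrow> T (Comp C g a)"
  shows "precomp a d S c T \<in> hom (functor_cat C set_cat) (subrep d S) (subrep c T)"
  unfolding precomp_def
proof (rule set_nat_trans_in_hom[OF is_functor_subrep[OF S] is_functor_subrep[OF T]])
  fix i x assume "i \<in> Ob C" "x \<in> FOb (subrep d S) i"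
  then show "enc (Comp C (dec x) a) \<in> FOb (subrep c T) i"
    using Comp_in_hom[OF a] ST by (auto simp: FOb_subrep)
next
  fix u i j x assume u: "u \<in> hom C i j" and x: "x \<in> FOb (subrep d S) i"
  have "i \<in> Ob C" using u Dom_in_Ob by (auto simp: hom_def)
  with x obtain g where g: "x = enc g" "g \<in> hom C d i" "S g" by (auto simp: FOb_subrep)
  note ga = Comp_in_hom[OF a g(2)] ST[OF g(2,3)]
  show "enc (Comp C (dec (act (subrep d S) u x)) a) = act (subrep c T) u (enc (Comp C (dec x) a))"
    using g ga act_subrep[of g d i S u j, OF g(2,3) u] act_subrep[of "Comp C g a" c i T u j, OF ga u] Comp_in_hom[OF g(2) u]
      Comp_assoc[OF a g(2) u] by simp
qed

text \<open>The transformation out of hom(c, -) whose value at the identity of \<open>c\<close> is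
  \<open>x\<close>. The always-true predicate selects the whole representable functor.\<close>

definition yoneda :: "('o, 'm, 'u) diagram \<Rightarrow> 'o \<Rightarrow> 'u \<Rightarrow>
    ('o, 'm, 'u) diagram_map" where
  "yoneda F c x = set_nat_trans (subrep c (\<lambda>_. True)) F (\<lambda>i z. act F (dec z) x)"

lemma cosieve_True: "cosieve c (\<lambda>_. True)"
  by (simp add: cosieve_def)

lemma component_yoneda:
  "i \<in> Ob C \<Longrightarrow> g \<in> hom C c i \<Longrightarrow> component (yoneda F c x) i (enc g) = act F g x"
  by (auto simp: yoneda_def component_set_nat_trans FOb_subrep)

lemma yoneda_in_hom:
  assumes F: "is_functor C set_cat F" and x: "x \<in> FOb F c"
  shows "yoneda F c x \<in> hom (functor_cat C set_cat) (subrep c (\<lambda>_. True)) F"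
  unfolding yoneda_def
proof (rule set_nat_trans_in_hom[OF is_functor_subrep[OF cosieve_True] F])
  fix i z assume "i \<in> Ob C" "z \<in> FOb (subrep c (\<lambda>_. True)) i"
  then show "act F (dec z) x \<in> FOb F i"
    using act_in[OF F _ x] by (auto simp: FOb_subrep)
next
  fix u i j z assume u: "u \<in> hom C i j" and z: "z \<in> FOb (subrep c (\<lambda>_. True)) i"
  have "i \<in> Ob C" using u Dom_in_Ob by (auto simp: hom_def)
  with z obtain g where g: "z = enc g" "g \<in> hom C c i" by (auto simp: FOb_subrep)
  show "act F (dec (act (subrep c (\<lambda>_. True)) u z)) x = act F u (act F (dec z) x)"
    using g act_subrep[OF g(2) TrueI u] Comp_in_hom[OF g(2) u] act_Comp[OF F g(2) u x] by simp
qed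

lemma yoneda_Id:
  assumes "is_functor C set_cat F" "c \<in> Ob C" "x \<in> FOb F c"
  shows "component (yoneda F c x) c (enc (Id C c)) = x"
  using assms by (simp add: component_yoneda Id_in_hom act_Id)

text \<open>The Yoneda correspondence is natural in the diagram: evaluated at an arrow
  \<open>g\<close> out of \<open>c\<close>, the equation is the naturality of \<open>t\<close> at
  \<open>g\<close>.\<close>

lemma Comp_yoneda:
  assumes t: "t \<in> hom (functor_cat C set_cat) F G" and c: "c \<in> Ob C" and x: "x \<in> FOb F c"
  shows "Comp (functor_cat C set_cat) t (yoneda F c x) = yoneda G c (component t c x)"
proof -
  interpret D: category "functor_cat C set_cat"
    by (intro category_functor_cat category_axioms category_set_cat)
  note y = yoneda_in_hom[OF hom_functor_catD(1)[OF t] x]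
  show ?thesis
  proof (rule nat_trans_eqI[OF D.Comp_in_hom[OF y t]
        yoneda_in_hom[OF hom_functor_catD(2)[OF t] component_in[OF t c x]]])
    fix i z assume i: "i \<in> Ob C" and z: "z \<in> FOb (subrep c (\<lambda>_. True)) i"
    then obtain g where g: "z = enc g" "g \<in> hom C c i" by (auto simp: FOb_subrep)
    show "component (Comp (functor_cat C set_cat) t (yoneda F c x)) i z =
      component (yoneda G c (component t c x)) i z"
      using component_Comp[OF y t i z] naturality[OF t g(2) x] g i by (simp add: component_yoneda)
  qed
qed

lemma yoneda_inj:
  assumes "is_functor C set_cat F" "c \<in> Ob C" "x \<in> FOb F c" "y \<in> FOb F c"
    and "yoneda F c x = yoneda F c y"
  shows "x = y"
  by (rule trans[OF yoneda_Id[OF assms(1-3), symmetric, unfolded assms(5)] yoneda_Id[OF assms(1,2,4)]])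

text \<open>Elements of \<open>B\<close> at \<open>c\<close> are maps from hom(c, -) to
  \<open>B\<close>. Elements with the same image under \<open>m\<close> give maps with the same
  composite with \<open>m\<close>, and these can be cancelled.\<close>

lemma monic_functor_cat_inj:
  fixes B G :: "('o, 'm, 'u) diagram"
  assumes m: "m \<in> hom (functor_cat C set_cat) B G" and mono: "monic (functor_cat C set_cat) m"
    and c: "c \<in> Ob C"
  shows "inj_on (component m c) (FOb B c)"
proof (rule inj_onI)
  fix x y assume x: "x \<in> FOb B c" and y: "y \<in> FOb B c" and e: "component m c x = component m c y"
  note B = hom_functor_catD(1)[OF m]
  have "yoneda B c x = yoneda B c y"
    using mono m yoneda_in_hom[OF B x] yoneda_in_hom[OF B y]
      Comp_yoneda[OF m c x] Comp_yoneda[OF m c y] e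
    unfolding monic_def hom_functor_cat by simp
  then show "x = y" by (rule yoneda_inj[OF B c x y])
qed

text \<open>By Yoneda, compatible elements \<open>x\<close> and \<open>y\<close> are a compatible
  pair of maps out of hom(c, -). The mediating map \<open>h\<close>, evaluated at the identity of
  \<open>c\<close>, is the required element; any other solution has a Yoneda map that mediates too,
  hence equals \<open>h\<close>.\<close>

lemma pullback_square_functor_catD:
  fixes P A B G :: "('o, 'm, 'u) diagram"
  assumes p: "p \<in> hom (functor_cat C set_cat) P A" and q: "q \<in> hom (functor_cat C set_cat) P B"
    and f: "f \<in> hom (functor_cat C set_cat) A G" and g: "g \<in> hom (functor_cat C set_cat) B G"
    and pb: "pullback_square (functor_cat C set_cat) p q f g" and c: "c \<in> Ob C"
  shows "elementwise_pullback (FOb P c) (FOb A c) (FOb B c)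
    (component p c) (component q c) (component f c) (component g c)"
  unfolding elementwise_pullback_def
proof (intro ballI impI)
  let ?D = "functor_cat C set_cat" and ?Y = "subrep c (\<lambda>_. True)"
  fix x y assume x: "x \<in> FOb A c" and y: "y \<in> FOb B c" and e: "component f c x = component g c y"
  note P = hom_functor_catD(1)[OF p] and A = hom_functor_catD(1)[OF f]
    and B = hom_functor_catD(1)[OF g]
  note yx = yoneda_in_hom[OF A x] and yy = yoneda_in_hom[OF B y]
  have "Comp ?D f (yoneda A c x) = Comp ?D g (yoneda B c y)"
    by (simp add: Comp_yoneda[OF f c x] Comp_yoneda[OF g c y] e)
  then have ex: "\<exists>!h. h \<in> hom ?D ?Y P \<and> Comp ?D p h = yoneda A c x \<and> Comp ?D q h = yoneda B c y"
    by (rule pullback_squareD[OF pb p f g yx yy])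
  then obtain h where h: "h \<in> hom ?D ?Y P" "Comp ?D p h = yoneda A c x" "Comp ?D q h = yoneda B c y"
    by blast
  have i: "enc (Id C c) \<in> FOb ?Y c" using c Id_in_hom by (auto simp: FOb_subrep)
  let ?z = "component h c (enc (Id C c))"
  show "\<exists>!z. z \<in> FOb P c \<and> component p c z = x \<and> component q c z = y"
  proof (rule ex1I[of _ ?z])
    show "?z \<in> FOb P c \<and> component p c ?z = x \<and> component q c ?z = y"
      using component_in[OF h(1) c i] component_Comp[OF h(1) p c i] component_Comp[OF h(1) q c i]
        h(2,3) yoneda_Id[OF A c x] yoneda_Id[OF B c y] by simp
    fix z assume z: "z \<in> FOb P c \<and> component p c z = x \<and> component q c z = y"
    have "yoneda P c z = h"
      using ex h yoneda_in_hom[OF P conjunct1[OF z]] Comp_yoneda[OF p c conjunct1[OF z]]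
        Comp_yoneda[OF q c conjunct1[OF z]] z by metis
    then show "z = ?z" using yoneda_Id[OF P c conjunct1[OF z]] by simp
  qed
qed


section \<open>Colimits of sets\<close>

text \<open>A predicate that the transition maps preserve and reflect is a cocone to a two-point
  set, so it descends to the colimit. Existence of \<open>h\<close> separates points of the colimit,
  while uniqueness of \<open>h\<close> gives joint surjectivity of the cocone.\<close>

lemma colimit_two_valued:
  fixes F :: "('o, 'm, 'u) diagram" and a b :: 'u
  assumes col: "colimit_cocone C set_cat F X \<eta>"
    and Q: "\<And>u i j x. u \<in> hom C i j \<Longrightarrow> x \<in> FOb F i \<Longrightarrow> Q j (act F u x) \<longleftrightarrow> Q i x"
  shows "\<exists>!h. h \<in> hom set_cat X {a, b} \<and>
    (\<forall>i\<in>Ob C. \<forall>x\<in>FOb F i. app h (component \<eta> i x) = (if Q i x then a else b))"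
proof -
  interpret S: category set_cat by (rule category_set_cat)
  have cc: "cocone C set_cat F X \<eta>" using col by (simp add: colimit_cocone_def)
  note F = coconeD1(1)[OF cc] and e = coconeD[OF cc]
  define k where "k i = (FOb F i, {a, b}, \<lambda>x\<in>FOb F i. if Q i x then a else b)" for i
  have k: "k i \<in> hom set_cat (FOb F i) {a, b}" for i by (auto simp: k_def hom_set_cat)
  have ka: "app (k i) x = (if Q i x then a else b)" if "x \<in> FOb F i" for i x
    using that by (simp add: k_def)
  have n: "Comp set_cat (k (Cod C u)) (FMor F u) = k (Dom C u)" if "u \<in> Mor C" for u
  proof -
    have u: "u \<in> hom C (Dom C u) (Cod C u)" using that by (simp add: hom_def)
    note Fu = FMor_in_hom[OF F u]
    show ?thesis
      by (rule hom_set_cat_eqI[OF S.Comp_in_hom[OF Fu k] k])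
        (simp add: app_Comp[OF Fu k] ka act_in[OF F u] Q[OF u])
  qed
  have "cocone C set_cat F {a, b} \<lparr>Src = F, Tgt = const_functor C set_cat {a, b}, At = (\<lambda>i\<in>Ob C. k i)\<rparr>"
    by (rule cocone_exI[OF category_axioms category_set_cat F _ k n]) (simp add: set_cat_def)
  then have "\<exists>!h. h \<in> hom set_cat X {a, b} \<and> (\<forall>i\<in>Ob C. Comp set_cat h (At \<eta> i) =
      At \<lparr>Src = F, Tgt = const_functor C set_cat {a, b}, At = (\<lambda>i\<in>Ob C. k i)\<rparr> i)"
    using col unfolding colimit_cocone_def by blast
  then have ex: "\<exists>!h. h \<in> hom set_cat X {a, b} \<and> (\<forall>i\<in>Ob C. Comp set_cat h (At \<eta> i) = k i)"
    by (simp cong: conj_cong ball_cong)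
  have "Comp set_cat h (At \<eta> i) = k i \<longleftrightarrow>
      (\<forall>x\<in>FOb F i. app h (component \<eta> i x) = (if Q i x then a else b))"
    if h: "h \<in> hom set_cat X {a, b}" and i: "i \<in> Ob C" for h i
    using hom_set_cat_eqI[OF S.Comp_in_hom[OF e[OF i] h] k] app_Comp[OF e[OF i] h] ka by metis
  then have "(h \<in> hom set_cat X {a, b} \<and> (\<forall>i\<in>Ob C. Comp set_cat h (At \<eta> i) = k i)) \<longleftrightarrow>
      (h \<in> hom set_cat X {a, b} \<and>
      (\<forall>i\<in>Ob C. \<forall>x\<in>FOb F i. app h (component \<eta> i x) = (if Q i x then a else b)))" for h
    by blast
  with ex show ?thesis by simp
qed

lemma two_elements: obtains a b :: 'u where "a \<noteq> b"
proof -
  obtain a b :: 'u where "b \<notin> {a}"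
    using ex_new_if_finite[OF infinite_UNIV, of "{_}"] by blast
  then show thesis using that by blast
qed

text \<open>The indicator function of an invariant predicate factors through the colimit, so it
  cannot distinguish elements with the same image there. This replaces an explicit description of
  the colimit as a quotient.\<close>

lemma colimit_eqD:
  fixes F :: "('o, 'm, 'u) diagram"
  assumes col: "colimit_cocone C set_cat F X \<eta>"
    and i: "i \<in> Ob C" "x \<in> FOb F i" and j: "j \<in> Ob C" "y \<in> FOb F j"
    and e: "component \<eta> i x = component \<eta> j y"
    and Q: "\<And>u i j x. u \<in> hom C i j \<Longrightarrow> x \<in> FOb F i \<Longrightarrow> Q j (act F u x) \<longleftrightarrow> Q i x"
  shows "Q i x \<longleftrightarrow> Q j y"
proof -
  obtain a b :: 'u where ab: "a \<noteq> b" by (rule two_elements)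
  obtain h where "\<forall>i\<in>Ob C. \<forall>x\<in>FOb F i. app h (component \<eta> i x) = (if Q i x then a else b)"
    using colimit_two_valued[of F X \<eta> Q a b, OF col Q] by blast
  then have "(if Q i x then a else b) = (if Q j y then a else b)"
    using i j e by metis
  with ab show ?thesis by (auto split: if_splits)
qed

text \<open>A point outside the image of the cocone could be sent anywhere without disturbing the
  composites with the cocone, against the uniqueness of induced maps.\<close>

lemma colimit_surj:
  fixes F :: "('o, 'm, 'u) diagram"
  assumes col: "colimit_cocone C set_cat F X \<eta>" and y: "y \<in> X"
  obtains i x where "i \<in> Ob C" "x \<in> FOb F i" "component \<eta> i x = y"
proof (rule ccontr)
  assume "\<not> thesis"
  with that have no: "\<And>i x. i \<in> Ob C \<Longrightarrow> x \<in> FOb F i \<Longrightarrow> component \<eta> i x \<noteq> y" by blast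
  have cc: "cocone C set_cat F X \<eta>" using col by (simp add: colimit_cocone_def)
  obtain a b :: 'u where ab: "a \<noteq> b" by (rule two_elements)
  \<comment> \<open>\<open>h a\<close> and \<open>h b\<close> differ only at \<open>y\<close>, and
    both induce the constant cocone \<open>a\<close>, which belongs to the always-true
    predicate.\<close>
  define h where "h c = (X, {a, b}, \<lambda>z\<in>X. if z = y then c else a)" for c
  have "h c \<in> hom set_cat X {a, b} \<and>
      (\<forall>i\<in>Ob C. \<forall>x\<in>FOb F i. app (h c) (component \<eta> i x) = (if True then a else b))"
    if "c \<in> {a, b}" for c
    using that no app_in[OF coconeD[OF cc]] by (auto simp: h_def hom_set_cat)
  then have "h a = h b"
    using colimit_two_valued[of F X \<eta> "\<lambda>_ _. True" a b, OF col refl] by blast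
  then have "app (h a) y = app (h b) y" by simp
  with ab y show False by (simp add: h_def)
qed

lemma colimit_component:
  fixes F :: "('o, 'm, 'u) diagram"
  assumes col: "colimit_cocone C set_cat F X \<eta>"
  shows "i \<in> Ob C \<Longrightarrow> x \<in> FOb F i \<Longrightarrow> component \<eta> i x \<in> X"
    and "u \<in> hom C i j \<Longrightarrow> x \<in> FOb F i \<Longrightarrow> component \<eta> j (act F u x) = component \<eta> i x"
proof -
  have cc: "cocone C set_cat F X \<eta>" using col by (simp add: colimit_cocone_def)
  note F = coconeD1(1)[OF cc]
  show "component \<eta> i x \<in> X" if "i \<in> Ob C" "x \<in> FOb F i"
    by (rule app_in[OF coconeD[OF cc that(1)] that(2)])
  assume u: "u \<in> hom C i j" and x: "x \<in> FOb F i"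
  have j: "j \<in> Ob C" using u Cod_in_Ob by (auto simp: hom_def)
  have "Comp set_cat (At \<eta> j) (FMor F u) = At \<eta> i"
    using coconeD2[OF category_axioms category_set_cat cc, of u] u by (simp add: hom_def)
  then show "component \<eta> j (act F u x) = component \<eta> i x"
    using app_Comp[OF FMor_in_hom[OF F u] coconeD[OF cc j] x] by simp
qed


section \<open>Confluence\<close>

lemma confluentD:
  assumes "confluent C" "v \<in> hom C i k" "w \<in> hom C i j"
  obtains l s t where "s \<in> hom C k l" "t \<in> hom C j l" "Comp C s v = Comp C t w"
proof -
  have "v \<in> Mor C" "w \<in> Mor C" "Dom C v = Dom C w" "Cod C v = k" "Cod C w = j"
    using assms(2,3) by (auto simp: hom_def)
  then show thesis using assms(1) that unfolding confluent_def by metis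
qed

text \<open>With \<open>x\<close> fixed, being merged with \<open>x\<close> by some pair of arrows
  is invariant under the transition maps when \<open>C\<close> is confluent. It holds at
  \<open>x\<close> through identities, hence also at every element with the same image in the
  colimit.\<close>

lemma confluent_colimit_eqD:
  fixes F :: "('o, 'm, 'u) diagram"
  assumes conf: "confluent C" and col: "colimit_cocone C set_cat F X \<eta>"
    and i: "i \<in> Ob C" "x \<in> FOb F i" and j: "j \<in> Ob C" "y \<in> FOb F j"
    and e: "component \<eta> i x = component \<eta> j y"
  obtains k u v where "k \<in> Ob C" "u \<in> hom C i k" "v \<in> hom C j k" "act F u x = act F v y"
proof -
  have F: "is_functor C set_cat F" using col coconeD1(1) by (auto simp: colimit_cocone_def)
  define Q where "Q j y \<longleftrightarrow> (\<exists>k. \<exists>u\<in>hom C i k. \<exists>v\<in>hom C j k. act F u x = act F v y)" for j y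
  have Q: "Q j' (act F w y) \<longleftrightarrow> Q j y" if w: "w \<in> hom C j j'" and y: "y \<in> FOb F j" for w j j' y
  proof
    assume "Q j' (act F w y)"
    then obtain k u v where u: "u \<in> hom C i k" and v: "v \<in> hom C j' k"
      and "act F u x = act F v (act F w y)" by (auto simp: Q_def)
    then have "act F u x = act F (Comp C v w) y" by (simp add: act_Comp[OF F w v y])
    then show "Q j y" using u Comp_in_hom[OF w v] unfolding Q_def by blast
  next
    assume "Q j y"
    then obtain k u v where u: "u \<in> hom C i k" and v: "v \<in> hom C j k"
      and uv: "act F u x = act F v y" by (auto simp: Q_def)
    \<comment> \<open>Here confluence enters: completing the span \<open>v\<close>, \<open>w\<close>
      moves the merging of \<open>x\<close> and \<open>y\<close> from \<open>k\<close> to a stage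
      \<open>l\<close> that is also reached through \<open>w\<close>.\<close>
    obtain l s t where s: "s \<in> hom C k l" and t: "t \<in> hom C j' l"
      and st: "Comp C s v = Comp C t w"
      by (rule confluentD[OF conf v w])
    have "act F (Comp C s u) x = act F t (act F w y)"
      using act_Comp[OF F u s i(2)] act_Comp[OF F v s y] act_Comp[OF F w t y] uv st by simp
    then show "Q j' (act F w y)" using t Comp_in_hom[OF u s] unfolding Q_def by blast
  qed
  have "Q i x" using Id_in_hom[OF i(1)] unfolding Q_def by blast
  then have "Q j y" using colimit_eqD[of F X \<eta> i x j y Q, OF col i j e Q] by simp
  then show thesis using that Cod_in_Ob by (auto simp: Q_def hom_def)
qed

section \<open>The colimit functor on elements\<close>

lemma colimit_functorD:
  assumes "colimit_functor C D L \<eta>"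
  shows "is_functor (functor_cat C D) D L"
    and "is_functor C D F \<Longrightarrow> colimit_cocone C D F (FOb L F) (\<eta> F)"
    and "t \<in> hom (functor_cat C D) F G \<Longrightarrow> i \<in> Ob C \<Longrightarrow>
      Comp D (FMor L t) (At (\<eta> F) i) = Comp D (At (\<eta> G) i) (At t i)"
  using assms by (auto simp: colimit_functor_def hom_functor_cat)

lemma colimit_functor_component:
  fixes F G :: "('o, 'm, 'u) diagram"
  assumes L: "colimit_functor C set_cat L \<eta>" and t: "t \<in> hom (functor_cat C set_cat) F G"
    and i: "i \<in> Ob C" and x: "x \<in> FOb F i"
  shows "app (FMor L t) (component (\<eta> F) i x) = component (\<eta> G) i (component t i x)"
proof -
  interpret D: category "functor_cat C (set_cat :: ('u set, 'u smap) cat)"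
    by (intro category_functor_cat category_axioms category_set_cat)
  have cc: "cocone C set_cat H (FOb L H) (\<eta> H)" if "is_functor C set_cat H" for H
    using colimit_functorD(2)[OF L that] by (simp add: colimit_cocone_def)
  note e = coconeD[OF cc[OF hom_functor_catD(1)[OF t]] i] coconeD[OF cc[OF hom_functor_catD(2)[OF t]] i]
  show ?thesis
    using colimit_functorD(3)[OF L t i] x
      app_Comp[OF e(1) D.FMor_in_hom[OF colimit_functorD(1)[OF L] t] x]
      app_Comp[OF component_in_hom[OF t i] e(2) x] by simp
qed

section \<open>From confluence to commutation\<close>

lemma confluent_imp_commute:
  assumes conf: "confluent C"
  shows "colimits_commute_with_inverse_images C (set_cat :: ('u set, 'u smap) cat)"
  unfolding colimits_commute_with_inverse_images_def preserves_inverse_images_def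
proof (intro allI impI)
  let ?S = "set_cat :: ('u set, 'u smap) cat"
  let ?D = "functor_cat C ?S"
  interpret D: category ?D by (intro category_functor_cat category_axioms category_set_cat)
  fix L \<eta> p q f m
  assume "colimit_functor C ?S L \<eta>" and "inverse_image_square ?D p q f m"
  then have L: "colimit_functor C ?S L \<eta>" and pb: "pullback_square ?D p q f m" and mono: "monic ?D m"
    by (simp_all add: inverse_image_square_def)
  obtain P A B G where p: "p \<in> hom ?D P A" and q: "q \<in> hom ?D P B" and f: "f \<in> hom ?D A G"
    and m: "m \<in> hom ?D B G"
    using pb by (simp add: pullback_square_def hom_functor_cat)
  have com: "Comp ?D f p = Comp ?D m q" using pb by (simp add: pullback_square_def)
  note LF = colimit_functorD(1)[OF L] and col = colimit_functorD(2)[OF L]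
  note L_hom = D.FMor_in_hom[OF LF]
  note P = hom_functor_catD(1)[OF p] and A = hom_functor_catD(1)[OF f] and B = hom_functor_catD(1)[OF m]
    and G = hom_functor_catD(2)[OF m]
  note ppb = pullback_square_functor_catD[OF p q f m pb]
  note colP = col[OF P] and colA = col[OF A] and colB = col[OF B] and colG = col[OF G]
  have at: "app (FMor L t) (component (\<eta> F) i x) = component (\<eta> H) i (component t i x)"
    if t: "t \<in> hom ?D F H" and i: "i \<in> Ob C" and x: "x \<in> FOb F i" for t F H i x
    by (rule colimit_functor_component[OF L t i x])
  have "elementwise_pullback (FOb L P) (FOb L A) (FOb L B)
    (app (FMor L p)) (app (FMor L q)) (app (FMor L f)) (app (FMor L m))"
    unfolding elementwise_pullback_def
  proof (intro ballI impI ex_ex1I)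
    fix a b assume a: "a \<in> FOb L A" and b: "b \<in> FOb L B" and ab: "app (FMor L f) a = app (FMor L m) b"
    obtain i x where i: "i \<in> Ob C" and x: "x \<in> FOb A i" and ax: "component (\<eta> A) i x = a"
      by (rule colimit_surj[OF colA a])
    obtain j y where j: "j \<in> Ob C" and y: "y \<in> FOb B j" and yb: "component (\<eta> B) j y = b"
      by (rule colimit_surj[OF colB b])
    have "component (\<eta> G) i (component f i x) = component (\<eta> G) j (component m j y)"
      using at[OF f i x] at[OF m j y] ab ax yb by simp
    \<comment> \<open>Confluence carries both representatives to one stage \<open>k\<close> at which
      their images in \<open>G\<close> agree; the pullback at \<open>k\<close> then supplies the
      element of \<open>P\<close>.\<close>
    then obtain k u v where k: "k \<in> Ob C" and u: "u \<in> hom C i k" and v: "v \<in> hom C j k"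
      and uv: "act G u (component f i x) = act G v (component m j y)"
      by (rule confluent_colimit_eqD[OF conf colG i component_in[OF f i x] j component_in[OF m j y]])
    have "component f k (act A u x) = component m k (act B v y)"
      using uv naturality[OF f u x] naturality[OF m v y] by simp
    then obtain z where z: "z \<in> FOb P k" "component p k z = act A u x" "component q k z = act B v y"
      using elementwise_pullbackD[OF ppb[OF k] act_in[OF A u x] act_in[OF B v y]] by blast
    have "component (\<eta> P) k z \<in> FOb L P"
      by (rule colimit_component(1)[OF colP k z(1)])
    moreover have "app (FMor L p) (component (\<eta> P) k z) = a" "app (FMor L q) (component (\<eta> P) k z) = b"
      using at[OF p k z(1)] at[OF q k z(1)] colimit_component(2)[OF colA u x]
        colimit_component(2)[OF colB v y] z(2,3) ax yb by simp_all
    ultimately show "\<exists>z. z \<in> FOb L P \<and> app (FMor L p) z = a \<and> app (FMor L q) z = b" by blast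
  next
    fix a b z w
    assume z: "z \<in> FOb L P \<and> app (FMor L p) z = a \<and> app (FMor L q) z = b"
      and w: "w \<in> FOb L P \<and> app (FMor L p) w = a \<and> app (FMor L q) w = b"
    obtain i x where i: "i \<in> Ob C" and x: "x \<in> FOb P i" and zx: "component (\<eta> P) i x = z"
      using colimit_surj[OF colP] z by blast
    obtain j y where j: "j \<in> Ob C" and y: "y \<in> FOb P j" and wy: "component (\<eta> P) j y = w"
      using colimit_surj[OF colP] w by blast
    have "component (\<eta> A) i (component p i x) = component (\<eta> A) j (component p j y)"
      using at[OF p i x] at[OF p j y] z w zx wy by simp
    then obtain k u v where k: "k \<in> Ob C" and u: "u \<in> hom C i k" and v: "v \<in> hom C j k"
      and uv: "act A u (component p i x) = act A v (component p j y)"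
      by (rule confluent_colimit_eqD[OF conf colA i component_in[OF p i x] j component_in[OF p j y]])
    note ux = act_in[OF P u x] and vy = act_in[OF P v y]
    have pe: "component p k (act P u x) = component p k (act P v y)"
      using uv naturality[OF p u x] naturality[OF p v y] by simp
    have sq: "component f k (component p k t) = component m k (component q k t)" if "t \<in> FOb P k" for t
      using component_Comp[OF p f k that] component_Comp[OF q m k that] com by simp
    \<comment> \<open>The arrows \<open>u\<close> and \<open>v\<close> were chosen to merge the
      images in \<open>A\<close>. Commutativity of the square transfers this to the images in
      \<open>B\<close> after \<open>m\<close>, and injectivity of \<open>m\<close> at
      \<open>k\<close> cancels \<open>m\<close>, so the same stage serves both projections.\<close>
    have "component m k (component q k (act P u x)) = component m k (component q k (act P v y))"
      using sq[OF ux] sq[OF vy] pe by simp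
    then have qe: "component q k (act P u x) = component q k (act P v y)"
      by (rule inj_onD[OF monic_functor_cat_inj[OF m mono k] _ component_in[OF q k ux] component_in[OF q k vy]])
    have "act P u x = act P v y"
      using elementwise_pullbackD[OF ppb[OF k] component_in[OF p k ux] component_in[OF q k ux] sq[OF ux]]
        ux vy pe qe by metis
    then show "z = w"
      using colimit_component(2)[OF colP u x] colimit_component(2)[OF colP v y] zx wy by simp
  qed
  moreover have "Comp ?S (FMor L f) (FMor L p) = Comp ?S (FMor L m) (FMor L q)"
    using D.FMor_Comp[OF LF p f] D.FMor_Comp[OF LF q m] com by simp
  ultimately show "pullback_square ?S (FMor L p) (FMor L q) (FMor L f) (FMor L m)"
    using pullback_square_set_cat[OF L_hom[OF p] L_hom[OF q] L_hom[OF f] L_hom[OF m]] by blast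
qed

section \<open>From commutation to confluence\<close>

lemma commute_imp_confluent:
  assumes comm: "colimits_commute_with_inverse_images C (set_cat :: ('u set, 'u smap) cat)"
  shows "confluent C"
  unfolding confluent_def
proof (intro ballI impI)
  let ?S = "set_cat :: ('u set, 'u smap) cat"
  let ?D = "functor_cat C ?S"
  interpret D: category ?D by (intro category_functor_cat category_axioms category_set_cat)
  fix \<alpha> \<beta> assume \<alpha>\<beta>: "\<alpha> \<in> Mor C" "\<beta> \<in> Mor C" "Dom C \<alpha> = Dom C \<beta>"
  define c d e where "c = Dom C \<alpha>" and "d = Cod C \<alpha>" and "e = Cod C \<beta>"
  have \<alpha>: "\<alpha> \<in> hom C c d" and \<beta>: "\<beta> \<in> hom C c e"
    using \<alpha>\<beta> by (auto simp: hom_def c_def d_def e_def)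
  have cde: "c \<in> Ob C" "d \<in> Ob C" "e \<in> Ob C"
    using \<alpha>\<beta> Dom_in_Ob Cod_in_Ob by (auto simp: c_def d_def e_def)
  note Id_c = Id_in_hom[OF cde(1)] and Id_d = Id_in_hom[OF cde(2)] and Id_e = Id_in_hom[OF cde(3)]
  \<comment> \<open>\<open>T\<close> is the cosieve generated by \<open>\<beta>\<close> and
    \<open>S\<close> its inverse image along \<open>\<alpha>\<close>: an arrow in \<open>S\<close>
    is one half of a completion of the span.\<close>
  define T where "T g \<longleftrightarrow> (\<exists>j. \<exists>h\<in>hom C e j. g = Comp C h \<beta>)" for g
  define S where "S g \<longleftrightarrow> T (Comp C g \<alpha>)" for g
  let ?U = "\<lambda>_ :: 'm. True"
  have T: "cosieve c T"
    unfolding cosieve_def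
  proof (intro ballI allI impI)
    fix i j g u assume u: "u \<in> hom C i j" and g: "g \<in> hom C c i" and "T g"
    then obtain k h where h: "h \<in> hom C e k" "g = Comp C h \<beta>" by (auto simp: T_def)
    \<comment> \<open>\<open>T\<close> leaves the codomain of the second factor open; it is
      recovered from the codomain of the composite.\<close>
    have "k = i" using Comp_in_hom[OF \<beta> h(1)] g h(2) by (simp add: hom_def)
    with h u have "Comp C u h \<in> hom C e j" "Comp C u g = Comp C (Comp C u h) \<beta>"
      using Comp_in_hom Comp_assoc[OF \<beta>] by auto
    then show "T (Comp C u g)" unfolding T_def by blast
  qed
  have S: "cosieve d S"
    unfolding cosieve_def
  proof (intro ballI allI impI)
    fix i j g u assume u: "u \<in> hom C i j" and g: "g \<in> hom C d i" and "S g"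
    then show "S (Comp C u g)"
      using T Comp_in_hom[OF \<alpha> g] Comp_assoc[OF \<alpha> g u] unfolding S_def cosieve_def by metis
  qed
  define P A B G where "P = subrep d S" and "A = subrep d ?U" and "B = subrep c T" and "G = subrep c ?U"
  \<comment> \<open>\<open>p\<close> and \<open>m\<close> are inclusions, as precompositions with
    identities; \<open>q\<close> and \<open>f\<close> both precompose with
    \<open>\<alpha>\<close>.\<close>
  define p q f m where "p = precomp (Id C d) d S d ?U" and "q = precomp \<alpha> d S c T"
    and "f = precomp \<alpha> d ?U c ?U" and "m = precomp (Id C c) c T c ?U"
  have p: "p \<in> hom ?D P A" and q: "q \<in> hom ?D P B" and f: "f \<in> hom ?D A G" and m: "m \<in> hom ?D B G"
    using precomp_in_hom[OF S cosieve_True Id_d] precomp_in_hom[OF S T \<alpha>]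
      precomp_in_hom[OF cosieve_True cosieve_True \<alpha>] precomp_in_hom[OF T cosieve_True Id_c]
    by (simp_all add: p_def q_def f_def m_def P_def A_def B_def G_def S_def)
  have p_at: "component p i (enc g) = enc g" if "g \<in> hom C d i" "S g" for g i
    using component_precomp[of g d i S] that by (simp add: p_def Comp_Id_right)
  have q_at: "component q i (enc g) = enc (Comp C g \<alpha>)" if "g \<in> hom C d i" "S g" for g i
    using component_precomp[of g d i S] that by (simp add: q_def)
  have f_at: "component f i (enc g) = enc (Comp C g \<alpha>)" if "g \<in> hom C d i" for g i
    using component_precomp[of g d i ?U] that by (simp add: f_def)
  have m_at: "component m i (enc g) = enc g" if "g \<in> hom C c i" "T g" for g i
    using component_precomp[of g c i T] that by (simp add: m_def Comp_Id_right)
  have P_ob: "FOb P i = enc ` {g \<in> hom C d i. S g}" and A_ob: "FOb A i = enc ` hom C d i"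
    and B_ob: "FOb B i = enc ` {g \<in> hom C c i. T g}" if "i \<in> Ob C" for i
    using that by (simp_all add: P_def A_def B_def FOb_subrep)
  have com: "Comp ?D f p = Comp ?D m q"
  proof (rule nat_trans_eqI[OF D.Comp_in_hom[OF p f] D.Comp_in_hom[OF q m]])
    fix i z assume i: "i \<in> Ob C" and z: "z \<in> FOb P i"
    then obtain g where g: "z = enc g" "g \<in> hom C d i" "S g" by (auto simp: P_ob)
    show "component (Comp ?D f p) i z = component (Comp ?D m q) i z"
      using component_Comp[OF p f i z] component_Comp[OF q m i z] g p_at[OF g(2,3)] q_at[OF g(2,3)]
        f_at[OF g(2)] m_at[OF Comp_in_hom[OF \<alpha> g(2)]] by (simp add: S_def)
  qed
  have pb: "elementwise_pullback (FOb P i) (FOb A i) (FOb B i)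
      (component p i) (component q i) (component f i) (component m i)" if i: "i \<in> Ob C" for i
    unfolding elementwise_pullback_def
  proof (intro ballI impI)
    fix x y assume "x \<in> FOb A i" "y \<in> FOb B i" and e: "component f i x = component m i y"
    then obtain g h where g: "x = enc g" "g \<in> hom C d i" and h: "y = enc h" "h \<in> hom C c i" "T h"
      by (auto simp: A_ob[OF i] B_ob[OF i])
    \<comment> \<open>\<open>enc\<close> is known to be injective only on arrows of
      \<open>C\<close>, so the equation of codes is decoded through typed arrows.\<close>
    have "dec (enc (Comp C g \<alpha>)) = dec (enc h)"
      using e g h f_at[OF g(2)] m_at[OF h(2,3)] by simp
    then have gh: "Comp C g \<alpha> = h" using dec_enc[OF Comp_in_hom[OF \<alpha> g(2)]] dec_enc[OF h(2)] by simp
    then have "S g" using h(3) by (simp add: S_def)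
    then show "\<exists>!z. z \<in> FOb P i \<and> component p i z = x \<and> component q i z = y"
      using g h gh p_at q_at by (intro ex1I[of _ x]) (auto simp: P_ob[OF i])
  qed
  have "monic ?D m"
    by (rule monic_functor_catI[OF m]) (auto simp: B_ob m_at intro!: inj_onI)
  then have inv: "inverse_image_square ?D p q f m"
    unfolding inverse_image_square_def using pullback_square_functor_catI[OF p q f m com pb] by blast
  have "Mor C \<lesssim> (UNIV :: 'u set)" using inj_enc by (auto simp: lepoll_def)
  \<comment> \<open>The assumption \<open>comm\<close> speaks about all colimit functors, so one has
    to exist before anything can be drawn from it.\<close>
  then obtain L \<eta> where L: "colimit_functor C ?S L \<eta>"
    using set_cat_colimit_functor_exists[OF category_axioms infinite_UNIV] by blast
  note LF = colimit_functorD(1)[OF L]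
  note L_hom = D.FMor_in_hom[OF LF]
  have "pullback_square ?S (FMor L p) (FMor L q) (FMor L f) (FMor L m)"
    using comm L inv
    by (auto simp: colimits_commute_with_inverse_images_def preserves_inverse_images_def)
  then have Lpb: "elementwise_pullback (FOb L P) (FOb L A) (FOb L B)
    (app (FMor L p)) (app (FMor L q)) (app (FMor L f)) (app (FMor L m))"
    using pullback_square_set_cat[OF L_hom[OF p] L_hom[OF q] L_hom[OF f] L_hom[OF m]] by blast
  note col = colimit_functorD(2)[OF L]
  note colP = col[OF hom_functor_catD(1)[OF p]] and colA = col[OF hom_functor_catD(1)[OF f]]
    and colB = col[OF hom_functor_catD(1)[OF m]] and colG = col[OF hom_functor_catD(2)[OF m]]
  \<comment> \<open>The points to be matched over \<open>G\<close> are the class of the identity of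
    \<open>d\<close> in \<open>A\<close> and the class of the generator \<open>\<beta>\<close> in
    \<open>B\<close>.\<close>
  have x: "enc (Id C d) \<in> FOb A d" using cde Id_d by (auto simp: A_ob)
  have T\<beta>: "T \<beta>" using Id_e \<beta> Comp_Id_left[OF \<beta>] unfolding T_def by metis
  have y: "enc \<beta> \<in> FOb B e" using cde \<beta> T\<beta> by (auto simp: B_ob)
  have G_c: "enc (Id C c) \<in> FOb G c" using cde Id_c by (auto simp: G_def FOb_subrep)
  \<comment> \<open>The transition map along \<open>g\<close> sends the identity of \<open>c\<close>
    to \<open>g\<close>, so every element of hom(c, -) has the class of that identity.\<close>
  have G_eq: "component (\<eta> G) i (enc g) = component (\<eta> G) c (enc (Id C c))" if "g \<in> hom C c i" for g i
    using colimit_component(2)[OF colG that G_c] act_subrep[of "Id C c" c c ?U g i] Id_c that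
    by (simp add: G_def Comp_Id_right)
  \<comment> \<open>The two points are sent to the classes of \<open>\<alpha>\<close> and
    \<open>\<beta>\<close> in the colimit of \<open>G\<close>, which coincide by
    \<open>G_eq\<close>.\<close>
  have "app (FMor L f) (component (\<eta> A) d (enc (Id C d))) = app (FMor L m) (component (\<eta> B) e (enc \<beta>))"
    using colimit_functor_component[OF L f cde(2) x] colimit_functor_component[OF L m cde(3) y]
      f_at[OF Id_d] m_at[OF \<beta> T\<beta>] G_eq[OF \<alpha>] G_eq[OF \<beta>] by (simp add: Comp_Id_left[OF \<alpha>])
  then obtain z where z: "z \<in> FOb L P"
    using elementwise_pullbackD[OF Lpb colimit_component(1)[OF colA cde(2) x]
        colimit_component(1)[OF colB cde(3) y]] by blast
  \<comment> \<open>A point of the colimit of \<open>P\<close> comes from some stage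
    \<open>j\<close>, that is, from an arrow \<open>g\<close> out of \<open>d\<close> whose
    composite with \<open>\<alpha>\<close> factors through \<open>\<beta>\<close>.\<close>
  obtain j w where j: "j \<in> Ob C" and "w \<in> FOb P j" by (rule colimit_surj[OF colP z])
  then obtain g where g: "g \<in> hom C d j" and "T (Comp C g \<alpha>)" by (auto simp: P_ob S_def)
  then obtain k h where h: "h \<in> hom C e k" "Comp C g \<alpha> = Comp C h \<beta>" by (auto simp: T_def)
  have "k = j"
    using Comp_in_hom[OF \<beta> h(1)] Comp_in_hom[OF \<alpha> g] h(2) by (simp add: hom_def)
  with g h j show "\<exists>j\<in>Ob C. \<exists>\<beta>\<^sub>1\<in>hom C (Cod C \<alpha>) j. \<exists>\<beta>\<^sub>2\<in>hom C (Cod C \<beta>) j.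
      Comp C \<beta>\<^sub>1 \<alpha> = Comp C \<beta>\<^sub>2 \<beta>"
    unfolding d_def e_def by blast
qed

end

theorem theorem1p3p2:
  fixes I :: "('o, 'm) cat"
  assumes "category I"
    and "infinite (UNIV :: 'u set)"
    and "Mor I \<lesssim> (UNIV :: 'u set)"
  shows "colimits_commute_with_inverse_images I
           (set_cat :: ('u set, 'u set \<times> 'u set \<times> ('u \<Rightarrow> 'u)) cat)
         \<longleftrightarrow> confluent I"
proof -
  obtain enc :: "'m \<Rightarrow> 'u" where "inj_on enc (Mor I)"
    using assms(3) by (auto simp: lepoll_def)
  then interpret small_category I enc
    using assms by (simp add: small_category_def small_category_axioms_def)
  show ?thesis using confluent_imp_commute commute_imp_confluent by blast
qed

end
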